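(* Given a weighted pushdown game $\mathcal{G}$, the following problems are undecidable: (1) whether player 1 has a winning strategy (respectively a finite-memory winning strategy) for the objective $\Phi\bowtie 0$, where $\Phi\in\{\mathrm{LimSupAvg},\mathrm{LimInfAvg}\}$ and $\bowtie\in\{\geq,>\}$; (2) whether player 1 has a winning strategy (respectively a finite-memory winning strategy) for the objective $\Phi\bowtie 0$ together with stack boundedness, for the same $\Phi$ and $\bowtie$.
   Context: A weighted pushdown system (WPS) is $\mathcal{A}=\langle Q,\Gamma,q_0,E,w\rangle$ with finite states $Q$, finite stack alphabet $\Gamma\ni\bot$ ($\bot$ never pushed or popped), edges $E\subseteq(Q\times\Gamma)\times(Q\times\mathrm{Com}(\Gamma))$ with $\mathrm{Com}(\Gamma)=\{\mathit{skip},\mathit{pop}\}\cup\{\mathit{push}(z)\}$, weights $w:E\to\mathbb{Z}$; configurations $(\alpha,q)$ with $\alpha\in\Gamma^+$; successor of $(\alpha,q)$ via an edge $(q,\mathrm{Top}(\alpha),q',\mathit{com})$ is $(\mathit{com}(\alpha),q')$. A weighted pushdown game (WPG) is a WPS together with a partition $(Q_1,Q_2)$ of $Q$; it defines an infinite game graph on configurations, where configurations with state in $Q_i$ belong to player $i$, starting at $(\bot,q_0)$; in each round the owner of the current configuration chooses a successor configuration, producing an infinite play. A strategy for player 1 maps each finite history (sequence of configurations) ending in a player-1 configuration to a successor configuration; it is finite-memory if implementable by a finite-state transducer. A play is consistent with a strategy if all player-1 moves follow it. A player-1 strategy is winning for an objective if every consistent play (against every player-2 strategy) satisfies it. For an infinite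 play $\pi$, $\mathrm{LimSupAvg}(\pi)=\limsup_i w(\pi[0,i])/i$, $\mathrm{LimInfAvg}(\pi)=\liminf_i w(\pi[0,i])/i$; the objective $\Phi\bowtie 0$ is the set of plays with $\Phi(\pi)\bowtie 0$. Stack boundedness requires that the stack heights along the play be bounded. *)

theory Defs
  imports Complex_Main "HOL-Library.Extended_Real" "HOL-Library.Liminf_Limsup"
          "HOL-Library.Nat_Bijection"
begin

datatype recf = Zero | Succ | Proj nat | Comp recf "recf list" | Prim recf recf | Mu recf

inductive eval_recf :: "recf \<Rightarrow> nat list \<Rightarrow> nat \<Rightarrow> bool" where
  "eval_recf Zero xs 0"
| "eval_recf Succ (x # xs) (Suc x)"
| "i < length xs \<Longrightarrow> eval_recf (Proj i) xs (xs ! i)"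
| "list_all2 (\<lambda>g y. eval_recf g xs y) gs ys \<Longrightarrow> eval_recf f ys z \<Longrightarrow> eval_recf (Comp f gs) xs z"
| "eval_recf g xs y \<Longrightarrow> eval_recf (Prim g h) (0 # xs) y"
| "eval_recf (Prim g h) (n # xs) y \<Longrightarrow> eval_recf h (y # n # xs) z \<Longrightarrow> eval_recf (Prim g h) (Suc n # xs) z"
| "eval_recf f (n # xs) 0 \<Longrightarrow> (\<forall>m<n. \<exists>k. eval_recf f (m # xs) (Suc k)) \<Longrightarrow> eval_recf (Mu f) xs n"

definition decidable_on :: "('a \<Rightarrow> nat) \<Rightarrow> ('a \<Rightarrow> bool) \<Rightarrow> ('a \<Rightarrow> bool) \<Rightarrow> bool" where
  "decidable_on enc valid P \<longleftrightarrow>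
     (\<exists>f. \<forall>x. valid x \<longrightarrow> eval_recf f [enc x] (if P x then 1 else 0))"

text \<open>States are naturals below nQ, stack symbols naturals below nG, the bottom symbol is 0.
  A stack is a list whose head is the top symbol.\<close>

datatype com = Skip | Pop | Push nat

type_synonym edge = "nat \<times> nat \<times> nat \<times> com \<times> int"
  \<comment> \<open>(q, top symbol, q', command, weight)\<close>

datatype wpg = WPG (nQ: nat) (nG: nat) (init: nat) (edges: "edge list") (p1: "nat list")
  \<comment> \<open>p1 lists the player-1 states; the other states belong to player 2\<close>

type_synonym config = "nat list \<times> nat"

fun apply_com :: "com \<Rightarrow> nat list \<Rightarrow> nat list" where
  "apply_com Skip a = a"
| "apply_com Pop a = tl a"
| "apply_com (Push z) a = z # a"

fun com_ok :: "nat \<Rightarrow> nat \<Rightarrow> com \<Rightarrow> bool" where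
  "com_ok n g Skip = True"
| "com_ok n g Pop = (g \<noteq> 0)"
| "com_ok n g (Push z) = (0 < z \<and> z < n)"

definition wf_wpg :: "wpg \<Rightarrow> bool" where
  "wf_wpg G \<longleftrightarrow>
     1 \<le> nG G \<and> init G < nQ G \<and> (\<forall>q \<in> set (p1 G). q < nQ G) \<and>
     (\<forall>(q, g, q', c, w) \<in> set (edges G). q < nQ G \<and> g < nG G \<and> q' < nQ G \<and> com_ok (nG G) g c) \<and>
     distinct (map (\<lambda>(q, g, q', c, w). (q, g, q', c)) (edges G)) \<and>
     (\<forall>q < nQ G. \<forall>g < nG G. \<exists>(q1, g1, q', c, w) \<in> set (edges G). q1 = q \<and> g1 = g)"

definition init_conf :: "wpg \<Rightarrow> config" where
  "init_conf G = ([0], init G)"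

definition edge_wt :: "edge \<Rightarrow> int" where
  "edge_wt e = (case e of (q, g, q', c, w) \<Rightarrow> w)"

definition step :: "wpg \<Rightarrow> config \<Rightarrow> edge \<Rightarrow> config \<Rightarrow> bool" where
  "step G cf e cf' \<longleftrightarrow> e \<in> set (edges G) \<and>
     (case e of (q, g, q', c, w) \<Rightarrow>
        snd cf = q \<and> fst cf \<noteq> [] \<and> hd (fst cf) = g \<and> cf' = (apply_com c (fst cf), q'))"

definition is_player1 :: "wpg \<Rightarrow> config \<Rightarrow> bool" where
  "is_player1 G cf \<longleftrightarrow> snd cf \<in> set (p1 G)"

definition is_history :: "wpg \<Rightarrow> config list \<Rightarrow> bool" where
  "is_history G h \<longleftrightarrow> h \<noteq> [] \<and> h ! 0 = init_conf G \<and>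
     (\<forall>i. Suc i < length h \<longrightarrow> (\<exists>e. step G (h ! i) e (h ! Suc i)))"

definition strategy1 :: "wpg \<Rightarrow> (config list \<Rightarrow> config) \<Rightarrow> bool" where
  "strategy1 G \<sigma> \<longleftrightarrow> (\<forall>h. is_history G h \<and> is_player1 G (last h) \<longrightarrow>
      (\<exists>e. step G (last h) e (\<sigma> h)))"

definition finite_memory :: "wpg \<Rightarrow> (config list \<Rightarrow> config) \<Rightarrow> bool" where
  "finite_memory G \<sigma> \<longleftrightarrow> (\<exists>(M :: nat set) m0 upd nxt. finite M \<and> m0 \<in> M \<and>
     (\<forall>m \<in> M. \<forall>cf. upd m cf \<in> M) \<and>
     (\<forall>h. is_history G h \<and> is_player1 G (last h) \<longrightarrow>
          \<sigma> h = nxt (foldl upd m0 (butlast h)) (last h)))"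

definition is_play :: "wpg \<Rightarrow> (nat \<Rightarrow> config) \<Rightarrow> (nat \<Rightarrow> edge) \<Rightarrow> bool" where
  "is_play G c e \<longleftrightarrow> c 0 = init_conf G \<and> (\<forall>i. step G (c i) (e i) (c (Suc i)))"

definition consistent :: "wpg \<Rightarrow> (config list \<Rightarrow> config) \<Rightarrow> (nat \<Rightarrow> config) \<Rightarrow> bool" where
  "consistent G \<sigma> c \<longleftrightarrow> (\<forall>i. is_player1 G (c i) \<longrightarrow> c (Suc i) = \<sigma> (map c [0..<Suc i]))"

definition prefix_wt :: "(nat \<Rightarrow> edge) \<Rightarrow> nat \<Rightarrow> int" where
  "prefix_wt e i = (\<Sum>j<i. edge_wt (e j))"

datatype avg = LimSupAvg | LimInfAvg
datatype cmp = Geq | Gt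

definition avg_val :: "avg \<Rightarrow> (nat \<Rightarrow> edge) \<Rightarrow> ereal" where
  "avg_val \<Phi> e = (let s = (\<lambda>i. ereal (real_of_int (prefix_wt e i) / real i)) in
      (case \<Phi> of LimSupAvg \<Rightarrow> limsup s | LimInfAvg \<Rightarrow> liminf s))"

definition objective :: "avg \<Rightarrow> cmp \<Rightarrow> (nat \<Rightarrow> edge) \<Rightarrow> bool" where
  "objective \<Phi> r e = (case r of Geq \<Rightarrow> avg_val \<Phi> e \<ge> 0 | Gt \<Rightarrow> avg_val \<Phi> e > 0)"

definition stack_bounded :: "(nat \<Rightarrow> config) \<Rightarrow> bool" where
  "stack_bounded c \<longleftrightarrow> (\<exists>B. \<forall>i. length (fst (c i)) \<le> B)"

definition player1_wins :: "wpg \<Rightarrow> avg \<Rightarrow> cmp \<Rightarrow> bool \<Rightarrow> bool \<Rightarrow> bool" where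
  "player1_wins G \<Phi> r bnd fm \<longleftrightarrow> (\<exists>\<sigma>. strategy1 G \<sigma> \<and> (fm \<longrightarrow> finite_memory G \<sigma>) \<and>
     (\<forall>c e. is_play G c e \<and> consistent G \<sigma> c \<longrightarrow>
        objective \<Phi> r e \<and> (bnd \<longrightarrow> stack_bounded c)))"

fun enc_com :: "com \<Rightarrow> nat" where
  "enc_com Skip = 0"
| "enc_com Pop = 1"
| "enc_com (Push z) = z + 2"

definition enc_edge :: "edge \<Rightarrow> nat" where
  "enc_edge e = (case e of (q, g, q', c, w) \<Rightarrow>
     prod_encode (q, prod_encode (g, prod_encode (q', prod_encode (enc_com c, int_encode w)))))"

definition enc_wpg :: "wpg \<Rightarrow> nat" where
  "enc_wpg G = prod_encode (nQ G, prod_encode (nG G, prod_encode (init G,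
      prod_encode (list_encode (map enc_edge (edges G)), list_encode (p1 G)))))"

end

theory Submission
  imports Defs "HOL-Library.Sublist"
begin

text \<open>
  Player 1 (the prover) writes a run of a counter program on the stack, one transition at a time.
  After every transition player 2 (the challenger) may claim that a zero test or a decrement was not
  allowed; the stack is then popped while the weights count the value of the counter in question.
  Weights are chosen such that a round in which the prover is honest gains at least 1 and a round
  ending with a justified challenge loses at least 1. If the program halts, repeating the halting
  run gives rounds of bounded length, hence a positive mean payoff. Otherwise the challenger keeps
  all partial sums bounded from above, and if in addition the stack is bounded, so is the length
  of the rounds and the mean payoff is negative. For the non-strict objective without
  stack boundedness the prover could make the losses negligible by playing ever longer rounds;
  there the roles of the players are exchanged and the weights are negated.

  A decider for the game would be a recursive function and hence could be compiled to a counter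
  program. The input of a program enters its game only as the weights of six edges at the bottom
  of the stack, so the code of the game is computable from the code of the remaining edges and the
  input. This allows a program to apply the decider to the game of the program itself and then to
  do the opposite.
\<close>

subsection \<open>Recursive functions\<close>

lemma eval_Proj: "i < length xs \<Longrightarrow> y = xs ! i \<Longrightarrow> eval_recf (Proj i) xs y"
  by (simp add: eval_recf.intros(3))

lemma eval_Comp1:
  "eval_recf g xs y \<Longrightarrow> eval_recf f [y] z \<Longrightarrow> eval_recf (Comp f [g]) xs z"
  by (rule eval_recf.intros(4)[where ys = "[y]"]) simp_all

lemma eval_Comp2:
  "eval_recf g xs y \<Longrightarrow> eval_recf g' xs y' \<Longrightarrow> eval_recf f [y, y'] z
    \<Longrightarrow> eval_recf (Comp f [g, g']) xs z"
  by (rule eval_recf.intros(4)[where ys = "[y, y']"]) simp_all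

primrec rconst :: "nat \<Rightarrow> recf" where
  "rconst 0 = Zero"
| "rconst (Suc n) = Comp Succ [rconst n]"

lemma eval_rconst: "eval_recf (rconst n) xs n"
  by (induction n) (auto intro: eval_recf.intros(1,2) eval_Comp1)

definition rpred :: recf where
  "rpred = Prim Zero (Proj 1)"

lemma eval_rpred: "eval_recf rpred [n] (n - 1)"
  unfolding rpred_def
proof (induction n)
  case 0
  show ?case by (auto intro: eval_recf.intros)
next
  case (Suc n)
  show ?case
    by (rule eval_recf.intros(6)[OF Suc]) (auto intro: eval_Proj)
qed

definition rnot :: recf where
  "rnot = Prim (rconst 1) Zero"

lemma eval_rnot: "eval_recf rnot [n] (if n = 0 then 1 else 0)"
  unfolding rnot_def
proof (induction n)
  case 0
  show ?case using eval_rconst[of 1] by (auto intro: eval_recf.intros)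
next
  case (Suc n)
  show ?case
    using eval_recf.intros(6)[OF Suc eval_recf.intros(1)] by simp
qed

definition radd :: recf where
  "radd = Prim (Proj 0) (Comp Succ [Proj 0])"

lemma eval_radd: "eval_recf radd [m, n] (m + n)"
  unfolding radd_def
proof (induction m)
  case 0
  show ?case by (auto intro!: eval_recf.intros(5) eval_Proj)
next
  case (Suc m)
  show ?case
    by (rule eval_recf.intros(6)[OF Suc])
      (auto intro!: eval_Comp1 eval_Proj eval_recf.intros(2))
qed

definition rtriangle :: recf where
  "rtriangle = Prim Zero (Comp radd [Proj 0, Comp Succ [Proj 1]])"

lemma eval_rtriangle: "eval_recf rtriangle [n] (triangle n)"
  unfolding rtriangle_def
proof (induction n)
  case 0
  show ?case by (auto intro: eval_recf.intros)
next
  case (Suc n)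
  have "eval_recf (Comp radd [Proj 0, Comp Succ [Proj 1]]) [triangle n, n] (triangle n + Suc n)"
    by (rule eval_Comp2[OF _ _ eval_radd])
      (auto intro!: eval_Comp1 eval_Proj eval_recf.intros(2))
  from eval_recf.intros(6)[OF Suc this] show ?case by simp
qed

text \<open>Cantor's pairing function \<open>triangle (m + n) + m\<close>, the form in which
  \<open>prod_encode\<close> is defined.\<close>

definition rpair :: "recf \<Rightarrow> recf \<Rightarrow> recf" where
  "rpair a b = Comp radd [Comp rtriangle [Comp radd [a, b]], a]"

lemma eval_rpair:
  "eval_recf a xs m \<Longrightarrow> eval_recf b xs n \<Longrightarrow> eval_recf (rpair a b) xs (prod_encode (m, n))"
  unfolding rpair_def prod_encode_def
  by (auto intro!: eval_Comp2 eval_Comp1 eval_radd eval_rtriangle)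

definition rcons :: "recf \<Rightarrow> recf \<Rightarrow> recf" where
  "rcons a b = Comp Succ [rpair a b]"

lemma eval_rcons:
  "eval_recf a xs (h x) \<Longrightarrow> eval_recf b xs (list_encode (map h ys))
    \<Longrightarrow> eval_recf (rcons a b) xs (list_encode (map h (x # ys)))"
  unfolding rcons_def by (auto intro!: eval_Comp1 eval_rpair eval_recf.intros(2))

subsection \<open>Counter programs\<close>

datatype ins = Inc nat | Loop nat "ins list"

text \<open>A \<open>Loop\<close> decrements its register on every entry. The list of instructions
  still to be executed is the whole control state, so a program can later be read as a counter
  automaton whose states are such lists.\<close>

inductive exec :: "ins list \<Rightarrow> (nat \<Rightarrow> nat) \<Rightarrow> (nat \<Rightarrow> nat) \<Rightarrow> bool" where
  exec_Nil: "exec [] v v"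
| exec_Inc: "exec k (v(r := Suc (v r))) v' \<Longrightarrow> exec (Inc r # k) v v'"
| exec_Exit: "v r = 0 \<Longrightarrow> exec k v v' \<Longrightarrow> exec (Loop r b # k) v v'"
| exec_Enter: "v r = Suc n \<Longrightarrow> exec (b @ Loop r b # k) (v(r := n)) v' \<Longrightarrow> exec (Loop r b # k) v v'"

inductive_cases exec_IncE: "exec (Inc r # k) v v'"
inductive_cases exec_LoopE: "exec (Loop r b # k) v v'"

lemma exec_append: "exec a v u \<Longrightarrow> exec b u w \<Longrightarrow> exec (a @ b) v w"
  by (induction rule: exec.induct) (auto intro: exec.intros)

lemma exec_Cons: "exec [i] v u \<Longrightarrow> exec b u w \<Longrightarrow> exec (i # b) v w"
  using exec_append[of "[i]"] by simp

lemma exec_Inc1: "exec [Inc r] v (v(r := Suc (v r)))"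
  by (intro exec.intros)

text \<open>Execution is deterministic, so a run of \<open>a @ b\<close> has to pass through the
  result of \<open>a\<close>. The induction is on the run of \<open>a\<close>, which is rotated to
  the front.\<close>

lemma exec_appendD: "exec (a @ b) v w \<Longrightarrow> exec a v u \<Longrightarrow> exec b u w"
  by (rotate_tac, induction arbitrary: w rule: exec.induct)
    (auto elim: exec_IncE exec_LoopE)

lemma exec_clear: "exec [Loop a []] v (v(a := 0))"
proof (induction "v a" arbitrary: v)
  case 0
  then have "v(a := 0) = v" by auto
  with 0 show ?case by (auto intro: exec.intros)
next
  case (Suc n)
  from Suc(1)[of "v(a := n)"] Suc(2) show ?case
    by (auto intro!: exec_Enter[where n = n])
qed

lemma exec_move:
  "a \<noteq> c \<Longrightarrow> exec [Loop a [Inc c]] v (v(a := 0, c := v c + v a))"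
proof (induction "v a" arbitrary: v)
  case 0
  then have eq: "v(a := 0, c := v c + v a) = v" by auto
  show ?case unfolding eq by (rule exec_Exit[OF _ exec_Nil]) (use 0 in simp)
next
  case (Suc n)
  let ?u = "v(a := n, c := Suc (v c))"
  have "?u(a := 0, c := ?u c + ?u a) = v(a := 0, c := v c + v a)"
    using Suc(2,3) by auto
  with Suc(1)[of ?u] Suc(2,3)
  have "exec [Loop a [Inc c]] ?u (v(a := 0, c := v c + v a))" by simp
  with Suc(3) have "exec ([Inc c] @ [Loop a [Inc c]]) (v(a := n)) (v(a := 0, c := v c + v a))"
    by (simp add: exec_Inc)
  then show ?case by (rule exec_Enter[rotated]) (simp add: Suc(2)[symmetric])
qed

text \<open>A loop destroys the register it reads, so the value is parked in \<open>t\<close> and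
  then restored to \<open>a\<close> while \<open>c\<close> is filled.\<close>

definition copy :: "nat \<Rightarrow> nat \<Rightarrow> nat \<Rightarrow> ins list" where
  "copy a c t = [Loop a [Inc t], Loop t [Inc a, Inc c]]"

lemma exec_copy_back:
  "a \<noteq> c \<Longrightarrow> a \<noteq> t \<Longrightarrow> c \<noteq> t \<Longrightarrow>
    exec [Loop t [Inc a, Inc c]] v (v(t := 0, a := v a + v t, c := v c + v t))"
proof (induction "v t" arbitrary: v)
  case 0
  then have eq: "v(t := 0, a := v a + v t, c := v c + v t) = v" by auto
  show ?case unfolding eq by (rule exec_Exit[OF _ exec_Nil]) (use 0 in simp)
next
  case (Suc n)
  let ?u = "v(t := n, a := Suc (v a), c := Suc (v c))"
  have *: "?u(t := 0, a := ?u a + ?u t, c := ?u c + ?u t)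
      = v(t := 0, a := v a + v t, c := v c + v t)"
    using Suc(2-) by auto
  from Suc(1)[of ?u] Suc(2-) *
  have "exec [Loop t [Inc a, Inc c]] ?u (v(t := 0, a := v a + v t, c := v c + v t))"
    by simp
  with Suc(3-) have "exec ([Inc a, Inc c] @ [Loop t [Inc a, Inc c]]) (v(t := n))
      (v(t := 0, a := v a + v t, c := v c + v t))"
    by (simp add: exec_Inc)
  then show ?case by (rule exec_Enter[rotated]) (simp add: Suc(2)[symmetric])
qed

lemma exec_copy:
  assumes "a \<noteq> c" "a \<noteq> t" "c \<noteq> t" "v t = 0" "v c = 0" "y = v a"
  shows "exec (copy a c t) v (v(c := y))"
proof -
  let ?u = "v(a := 0, t := v t + v a)"
  have *: "?u(t := 0, a := ?u a + ?u t, c := ?u c + ?u t) = v(c := y)"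
    using assms by auto
  from exec_Cons[OF exec_move[OF assms(2)] exec_copy_back[OF assms(1-3)], of v]
  show ?thesis unfolding copy_def * .
qed

section \<open>Compiling recursive functions to counter programs\<close>

primrec seqs :: "(nat list \<Rightarrow> nat \<Rightarrow> nat \<Rightarrow> ins list) list \<Rightarrow> nat list \<Rightarrow> nat \<Rightarrow> nat \<Rightarrow> ins list" where
  "seqs [] as k b = []"
| "seqs (p # ps) as k b = p as k b @ seqs ps as (Suc k) b"

text \<open>\<open>compile f as k b\<close> adds the value of \<open>f\<close> on the registers \<open>as\<close> to the (empty) register
  \<open>k\<close>; the registers from \<open>b\<close> upwards serve as scratch space and are left empty.\<close>

primrec compile :: "recf \<Rightarrow> nat list \<Rightarrow> nat \<Rightarrow> nat \<Rightarrow> ins list" where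
  "compile Zero = (\<lambda>as k b. [])"
| "compile Succ = (\<lambda>as k b. copy (hd as) k b @ [Inc k])"
| "compile (Proj i) = (\<lambda>as k b. copy (as ! i) k b)"
| "compile (Comp f gs) = (\<lambda>as k b.
     seqs (map compile gs) as b (b + length gs) @
     compile f [b..<b + length gs] k (b + length gs) @
     map (\<lambda>r. Loop r []) [b..<b + length gs])"
| "compile (Prim g h) = (\<lambda>as k b.
     copy (hd as) b (b + 3) @
     compile g (tl as) k (b + 3) @
     Loop b (compile h (k # (b + 1) # tl as) (b + 2) (b + 3) @
       [Loop k [], Loop (b + 2) [Inc k], Inc (b + 1)]) #
     [Loop (b + 1) []])"
| "compile (Mu f) = (\<lambda>as k b.
     compile f (k # as) b (b + 1) @
     [Loop b (Loop b [] # Inc k # compile f (k # as) b (b + 1))])"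

inductive_cases eval_ZeroE: "eval_recf Zero xs y"
inductive_cases eval_SuccE: "eval_recf Succ xs y"
inductive_cases eval_ProjE: "eval_recf (Proj i) xs y"
inductive_cases eval_CompE: "eval_recf (Comp f gs) xs y"
inductive_cases eval_PrimE: "eval_recf (Prim g h) xs y"
inductive_cases eval_Prim0E: "eval_recf (Prim g h) (0 # xs) y"
inductive_cases eval_PrimSucE: "eval_recf (Prim g h) (Suc n # xs) y"
inductive_cases eval_MuE: "eval_recf (Mu f) xs y"

text \<open>Unrolls the recursion into its successive values \<open>Y\<close>, which the compiled
  loop holds one after the other in its result register.\<close>

lemma eval_Prim_trace:
  "eval_recf (Prim g h) (n # xs) y \<Longrightarrow>
    \<exists>Y. eval_recf g xs (Y 0) \<and> (\<forall>i<n. eval_recf h (Y i # i # xs) (Y (Suc i))) \<and> Y n = y"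
proof (induction n arbitrary: y)
  case 0
  then have "eval_recf g xs y" by (auto elim: eval_Prim0E)
  then show ?case by (intro exI[of _ "\<lambda>_. y"]) simp
next
  case (Suc n)
  then obtain z where z: "eval_recf (Prim g h) (n # xs) z" "eval_recf h (z # n # xs) y"
    by (auto elim: eval_PrimSucE)
  from Suc.IH[OF z(1)] obtain Y where Y: "eval_recf g xs (Y 0)"
    "\<forall>i<n. eval_recf h (Y i # i # xs) (Y (Suc i))" "Y n = z" by blast
  with z(2) show ?case
    by (intro exI[of _ "Y(Suc n := y)"]) (auto simp: less_Suc_eq)
qed

text \<open>Arguments are restored and scratch registers emptied again, so the code may be repeated
  inside a loop. The placement of the registers is quantified because nested calls shift it.\<close>

definition computes :: "(nat list \<Rightarrow> nat \<Rightarrow> nat \<Rightarrow> ins list) \<Rightarrow> nat list \<Rightarrow> nat \<Rightarrow> bool" where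
  "computes p xs y \<longleftrightarrow> (\<forall>v as k b. map v as = xs \<longrightarrow> k \<notin> set as \<longrightarrow> k < b \<longrightarrow>
     (\<forall>a\<in>set as. a < b) \<longrightarrow> v k = 0 \<longrightarrow> (\<forall>r\<ge>b. v r = 0) \<longrightarrow> exec (p as k b) v (v(k := y)))"

lemma computesD:
  "computes p xs y \<Longrightarrow> map v as = xs \<Longrightarrow> k \<notin> set as \<Longrightarrow> k < b \<Longrightarrow> (\<And>a. a \<in> set as \<Longrightarrow> a < b)
    \<Longrightarrow> v k = 0 \<Longrightarrow> (\<And>r. r \<ge> b \<Longrightarrow> v r = 0) \<Longrightarrow> w = v(k := y) \<Longrightarrow> exec (p as k b) v w"
  unfolding computes_def by blast

lemma exec_seqs:
  "list_all2 (\<lambda>p y. computes p (map v as) y) ps ys \<Longrightarrow> (\<And>a. a \<in> set as \<Longrightarrow> a < k) \<Longrightarrow>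
    k + length ps \<le> b \<Longrightarrow> (\<And>r. r \<ge> k \<Longrightarrow> v r = 0) \<Longrightarrow>
    exec (seqs ps as k b) v (\<lambda>r. if k \<le> r \<and> r < k + length ps then ys ! (r - k) else v r)"
proof (induction ps arbitrary: ys k v)
  case Nil
  have eq: "(\<lambda>r. if k \<le> r \<and> r < k + length [] then ys ! (r - k) else v r) = v"
    by auto
  show ?case unfolding eq seqs.simps by (rule exec_Nil)
next
  case (Cons p ps)
  from Cons.prems(1) obtain y ys' where ys: "ys = y # ys'" "computes p (map v as) y"
    "list_all2 (\<lambda>p y. computes p (map v as) y) ps ys'" by (auto simp: list_all2_Cons1)
  let ?u = "v(k := y)"
  have lt: "a < k" "a \<noteq> k" "a < Suc k" "a < b" if "a \<in> set as" for a
    using Cons.prems(2)[OF that] Cons.prems(3) by auto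
  then have same: "map ?u as = map v as" by simp
  have 1: "exec (p as k b) v ?u"
    by (rule computesD[OF ys(2)]) (use lt Cons.prems(3,4) in auto)
  have 2: "exec (seqs ps as (Suc k) b) ?u
      (\<lambda>r. if Suc k \<le> r \<and> r < Suc k + length ps then ys' ! (r - Suc k) else ?u r)"
  proof (rule Cons.IH)
    show "list_all2 (\<lambda>p y. computes p (map ?u as) y) ps ys'" unfolding same by (rule ys(3))
  qed (use lt Cons.prems(3,4) in auto)
  have "(\<lambda>r. if Suc k \<le> r \<and> r < Suc k + length ps then ys' ! (r - Suc k) else ?u r)
    = (\<lambda>r. if k \<le> r \<and> r < k + length (p # ps) then ys ! (r - k) else v r)"
    by (rule ext) (auto simp: ys nth_Cons' not_le less_Suc_eq_le)
  with exec_append[OF 1 2] show ?case by simp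
qed

lemma exec_clears: "exec (map (\<lambda>r. Loop r []) rs) v (\<lambda>r. if r \<in> set rs then 0 else v r)"
proof (induction rs arbitrary: v)
  case Nil
  then show ?case by (auto intro: exec_Nil)
next
  case (Cons a rs)
  have "(\<lambda>r. if r \<in> set rs then 0 else (v(a := 0)) r) = (\<lambda>r. if r \<in> set (a # rs) then 0 else v r)"
    by auto
  with exec_Cons[OF exec_clear Cons[of "v(a := 0)"]] show ?case by simp
qed

lemma compile_Comp:
  assumes gs: "list_all2 (\<lambda>g y. computes (compile g) xs y) gs ys"
    and f: "computes (compile f) ys z"
  shows "computes (compile (Comp f gs)) xs z"
  unfolding computes_def
proof (intro allI impI)
  fix v :: "nat \<Rightarrow> nat" and as k b
  assume A: "map v as = xs" "k \<notin> set as" "k < b" "\<forall>a\<in>set as. a < b" "v k = 0"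
    "\<forall>r\<ge>b. v r = 0"
  let ?n = "length gs"
  let ?u = "\<lambda>r. if b \<le> r \<and> r < b + length (map compile gs) then ys ! (r - b) else v r"
  have len: "length ys = ?n" using gs by (simp add: list_all2_lengthD)
  have 1: "exec (seqs (map compile gs) as b (b + ?n)) v ?u"
    by (rule exec_seqs) (use A gs in \<open>auto simp: list_all2_map1\<close>)
  have "map ?u [b..<b + ?n] = ys"
    by (rule nth_equalityI) (auto simp: len)
  then have 2: "exec (compile f [b..<b + ?n] k (b + ?n)) ?u (?u(k := z))"
    by (rule computesD[OF f]) (use A in auto)
  have 3: "(\<lambda>r. if r \<in> set [b..<b + ?n] then 0 else (?u(k := z)) r) = v(k := z)"
    using A by auto
  from exec_append[OF 1 exec_append[OF 2 exec_clears[of "[b..<b + ?n]"]]]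
  show "exec (compile (Comp f gs) as k b) v (v(k := z))"
    unfolding 3 by simp
qed

lemma compile_Prim:
  assumes g: "computes (compile g) xs (Y 0)"
    and h: "\<And>i. i < n \<Longrightarrow> computes (compile h) (Y i # i # xs) (Y (Suc i))"
  shows "computes (compile (Prim g h)) (n # xs) (Y n)"
  unfolding computes_def
proof (intro allI impI)
  fix v :: "nat \<Rightarrow> nat" and as k b
  assume A: "map v as = n # xs" "k \<notin> set as" "k < b" "\<forall>a\<in>set as. a < b" "v k = 0"
    "\<forall>r\<ge>b. v r = 0"
  then obtain a as' where as: "as = a # as'" "v a = n" "map v as' = xs" by auto
  have ne: "x \<noteq> k" "x \<noteq> b" "x \<noteq> b + 1" "x < b + 3" if "x \<in> set as'" for x
    using A(2,4) that as(1) by auto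
  \<comment> \<open>The state after \<open>i\<close> rounds: \<open>b\<close> counts the rounds
    left, \<open>b + 1\<close> those done, and \<open>k\<close> holds the current value. The next
    value is built in \<open>b + 2\<close>.\<close>
  let ?st = "\<lambda>i. v(b := n - i, b + 1 := i, k := Y i)"
  let ?body = "compile h (k # (b + 1) # as') (b + 2) (b + 3) @
       [Loop k [], Loop (b + 2) [Inc k], Inc (b + 1)]"
  have 1: "exec (copy a b (b + 3)) v (v(b := n))"
    by (rule exec_copy) (use A as in auto)
  have 2: "exec (compile g as' k (b + 3)) (v(b := n)) (?st 0)"
    by (rule computesD[OF g]) (use A as in \<open>auto simp: fun_eq_iff\<close>)
  have body: "exec ?body ((?st i)(b := n - Suc i)) (?st (Suc i))" if "i < n" for i
  proof -
    let ?u = "(?st i)(b := n - Suc i)"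
    let ?u1 = "?u(b + 2 := Y (Suc i))"
    let ?u2 = "?u1(k := 0)"
    let ?u3 = "?u2(b + 2 := 0, k := ?u2 k + ?u2 (b + 2))"
    have eq: "map ?u as' = xs" unfolding as(3)[symmetric] using ne by simp
    have b1: "exec (compile h (k # (b + 1) # as') (b + 2) (b + 3)) ?u ?u1"
    proof (rule computesD[OF h[OF that]])
      show "map ?u (k # (b + 1) # as') = Y i # i # xs" using A(3) eq by simp
    qed (use A(3,4,6) as(1) in auto)
    have b2: "exec [Loop (b + 2) [Inc k]] ?u2 ?u3"
      by (rule exec_move) (use A in auto)
    have b3: "?u3(b + 1 := Suc (?u3 (b + 1))) = ?st (Suc i)"
      using A by (auto simp: fun_eq_iff)
    have "exec ?body ?u (?u3(b + 1 := Suc (?u3 (b + 1))))"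
      by (rule exec_append[OF b1 exec_Cons[OF exec_clear exec_Cons[OF b2 exec_Inc1]]])
    then show ?thesis by (simp only: b3)
  qed
  have loop: "exec [Loop b ?body] (?st i) (?st n)" if "i \<le> n" for i
    using that
  proof (induction rule: inc_induct)
    case base
    show ?case by (rule exec_Exit[OF _ exec_Nil]) (use A(3) in simp)
  next
    case (step i)
    have "?st i b = Suc (n - Suc i)" using A(3) step(2) by simp
    then show ?case
      using exec_append[OF body[OF step(2)] step(3)] by (rule exec_Enter)
  qed
  have 4: "(?st n)(b + 1 := 0) = v(k := Y n)"
    using A by (auto simp: fun_eq_iff)
  from exec_append[OF 1 exec_append[OF 2 exec_Cons[OF loop[of 0] exec_clear[of "b + 1"]]]]
  have "exec (copy a b (b + 3) @ compile g as' k (b + 3) @ Loop b ?body # [Loop (b + 1) []])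
      v (v(k := Y n))" by (simp only: 4 le0)
  then show "exec (compile (Prim g h) as k b) v (v(k := Y n))"
    by (simp add: as)
qed

lemma compile_Mu:
  assumes z: "computes (compile f) (n # xs) 0"
    and s: "\<And>i. i < n \<Longrightarrow> \<exists>y. computes (compile f) (i # xs) (Suc y)"
  shows "computes (compile (Mu f)) xs n"
  unfolding computes_def
proof (intro allI impI)
  fix v :: "nat \<Rightarrow> nat" and as k b
  assume A: "map v as = xs" "k \<notin> set as" "k < b" "\<forall>a\<in>set as. a < b" "v k = 0"
    "\<forall>r\<ge>b. v r = 0"
  let ?c = "compile f (k # as) b (b + 1)"
  \<comment> \<open>Register \<open>k\<close> holds the candidate and is passed to \<open>f\<close>
    as its first argument. Entering the loop has only decremented the value of \<open>f\<close> in
    \<open>b\<close>; the rest of it is cleared before the next attempt.\<close>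
  let ?body = "Loop b [] # Inc k # ?c"
  have run: "exec ?c (v(k := i)) (v(k := i, b := y))" if "computes (compile f) (i # xs) y" for i y
    by (rule computesD[OF that]) (use A in \<open>auto\<close>)
  have "exec (?c @ [Loop b ?body]) (v(k := i)) (v(k := n))" if "i \<le> n" for i
    using that
  proof (induction rule: inc_induct)
    case base
    have "v(k := n, b := 0) = v(k := n)" using A by auto
    with run[OF z] have "exec ?c (v(k := n)) (v(k := n))" by simp
    then show ?case
      by (rule exec_append[OF _ exec_Exit[OF _ exec_Nil]]) (use A(3,6) in simp)
  next
    case (step i)
    from s[OF step(2)] obtain y where y: "computes (compile f) (i # xs) (Suc y)" ..
    let ?w = "v(k := i, b := y)"
    have *: "(?w(b := 0))(k := Suc ((?w(b := 0)) k)) = v(k := Suc i)"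
      using A by auto
    have "exec (Inc k # ?c @ [Loop b ?body]) (?w(b := 0)) (v(k := n))"
      using exec_Cons[OF exec_Inc1[of k "?w(b := 0)", unfolded *] step(3)] .
    from exec_Cons[OF exec_clear this]
    have "exec (?body @ [Loop b ?body]) ((v(k := i, b := Suc y))(b := y)) (v(k := n))"
      by (simp only: append_Cons fun_upd_upd)
    then have "exec [Loop b ?body] (v(k := i, b := Suc y)) (v(k := n))"
      by (rule exec_Enter[rotated]) simp
    with run[OF y] show ?case by (rule exec_append)
  qed
  from this[of 0] have "exec (?c @ [Loop b ?body]) (v(k := 0)) (v(k := n))" by simp
  moreover have "v(k := 0) = v" using A(5) by auto
  ultimately show "exec (compile (Mu f) as k b) v (v(k := n))" by simp
qed

lemma compile_correct: "eval_recf f xs y \<Longrightarrow> computes (compile f) xs y"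
proof (induction f arbitrary: xs y)
  case Zero
  then have "y = 0" by (auto elim: eval_ZeroE)
  then show ?case by (auto simp: computes_def fun_upd_idem intro: exec_Nil)
next
  case Succ
  then obtain x xs' where x: "xs = x # xs'" "y = Suc x" by (auto elim: eval_SuccE)
  show ?case unfolding computes_def
  proof (intro allI impI)
    fix v :: "nat \<Rightarrow> nat" and as k b
    assume A: "map v as = xs" "k \<notin> set as" "k < b" "\<forall>a\<in>set as. a < b" "v k = 0"
      "\<forall>r\<ge>b. v r = 0"
    then obtain a as' where as: "as = a # as'" "v a = x" using x by auto
    have "exec (copy a k b) v (v(k := x))"
      by (rule exec_copy) (use A as in auto)
    from exec_append[OF this exec_Inc1[of k]]
    show "exec (compile Succ as k b) v (v(k := y))" by (simp add: as x)
  qed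
next
  case (Proj i)
  then have i: "i < length xs" "y = xs ! i" by (auto elim: eval_ProjE)
  show ?case unfolding computes_def
  proof (intro allI impI)
    fix v :: "nat \<Rightarrow> nat" and as k b
    assume A: "map v as = xs" "k \<notin> set as" "k < b" "\<forall>a\<in>set as. a < b" "v k = 0"
      "\<forall>r\<ge>b. v r = 0"
    then have as: "i < length as" "v (as ! i) = y" "as ! i \<in> set as" using i by auto
    have "exec (copy (as ! i) k b) v (v(k := y))"
      by (rule exec_copy) (use A as in auto)
    then show "exec (compile (Proj i) as k b) v (v(k := y))" by simp
  qed
next
  case (Comp f gs)
  from Comp.prems obtain ys where "list_all2 (\<lambda>g y. eval_recf g xs y) gs ys" "eval_recf f ys y"
    by (auto elim: eval_CompE)
  moreover from this(1) have "list_all2 (\<lambda>g y. computes (compile g) xs y) gs ys"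
    unfolding list_all2_conv_all_nth using Comp.IH(2) by fastforce
  ultimately show ?case using compile_Comp Comp.IH(1) by blast
next
  case (Prim g h)
  obtain n xs' where xs: "xs = n # xs'"
    by (rule eval_PrimE[OF Prim.prems]) auto
  from eval_Prim_trace[OF Prim.prems[unfolded xs]] obtain Y where Y: "eval_recf g xs' (Y 0)"
    "\<forall>i<n. eval_recf h (Y i # i # xs') (Y (Suc i))" "Y n = y" by blast
  show ?case unfolding xs Y(3)[symmetric]
    by (rule compile_Prim) (use Y(1,2) Prim.IH in blast)+
next
  case (Mu f)
  from Mu.prems have "eval_recf f (y # xs) 0" "\<forall>i<y. \<exists>k. eval_recf f (i # xs) (Suc k)"
    by (auto elim: eval_MuE)
  then show ?case by (intro compile_Mu) (use Mu.IH in blast)+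
qed

subsection \<open>Counter automata\<close>

datatype opn = OInc nat | ODec nat | OZero nat

fun ctr :: "opn \<Rightarrow> nat" where
  "ctr (OInc c) = c"
| "ctr (ODec c) = c"
| "ctr (OZero c) = c"

text \<open>The guards of \<open>OZero\<close> and \<open>ODec\<close> are left out: the prover may
  guess either branch, and it is up to the challenger to punish a wrong one.\<close>

fun succs :: "ins list \<Rightarrow> (opn \<times> ins list) set" where
  "succs [] = {}"
| "succs (Inc r # k) = {(OInc r, k)}"
| "succs (Loop r b # k) = {(OZero r, k), (ODec r, b @ Loop r b # k)}"

text \<open>The continuations met while executing a program in front of \<open>k\<close>, excluding \<open>k\<close> itself.\<close>

fun conts1 :: "ins \<Rightarrow> ins list \<Rightarrow> ins list set" and conts :: "ins list \<Rightarrow> ins list \<Rightarrow> ins list set" where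
  "conts1 (Inc r) k = {Inc r # k}"
| "conts1 (Loop r b) k = insert (Loop r b # k) (conts b (Loop r b # k))"
| "conts [] k = {}"
| "conts (i # is) k = conts1 i (is @ k) \<union> conts is k"

lemma finite_conts: "finite (conts1 i k)" "finite (conts is k)"
  by (induction i k and "is" k rule: conts1_conts.induct) auto

lemma conts_start: "i # k \<in> conts1 i k" "is @ k \<in> insert k (conts is k)"
  by (induction i k and "is" k rule: conts1_conts.induct) auto

text \<open>Together with \<open>finite_conts\<close> this makes the automaton of a program finite,
  and hence also the stack alphabet of its game.\<close>

lemma conts_closed:
  "s \<in> conts1 i k \<Longrightarrow> (x, s') \<in> succs s \<Longrightarrow> s' \<in> insert k (conts1 i k)"
  "s \<in> conts is k \<Longrightarrow> (x, s') \<in> succs s \<Longrightarrow> s' \<in> insert k (conts is k)"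
proof (induction i k and "is" k rule: conts1_conts.induct)
  case (2 r b k)
  then show ?case using conts_start(2)[of b "Loop r b # k"] by auto
next
  case (4 i "is" k)
  then show ?case using conts_start(2)[of "is" k] by auto
qed auto

subsection \<open>Mean payoff of sequences with linear bounds\<close>

text \<open>The bound holds for the limit inferior and therefore for the limit superior, so both
  kinds of average are treated at once.\<close>

lemma avg_val_ge:
  assumes "\<And>n. real_of_int (prefix_wt e n) \<ge> a * real n - C"
  shows "avg_val \<Phi> e \<ge> ereal a"
proof -
  let ?s = "\<lambda>i. ereal (real_of_int (prefix_wt e i) / real i)"
  have "(\<lambda>n. a - C / real n) \<longlonglongrightarrow> a - 0"
    by (intro tendsto_intros lim_const_over_n)
  then have "(\<lambda>n. ereal (a - C / real n)) \<longlonglongrightarrow> ereal a"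
    by simp
  then have "ereal a = liminf (\<lambda>n. ereal (a - C / real n))"
    by (metis lim_imp_Liminf trivial_limit_sequentially)
  also have "\<dots> \<le> liminf ?s"
  proof (rule Liminf_mono)
    show "\<forall>\<^sub>F n in sequentially. ereal (a - C / real n) \<le> ?s n"
      using eventually_gt_at_top[of 0]
    proof eventually_elim
      case (elim n)
      then have "(a - C / real n) * real n = a * real n - C" by (simp add: field_simps)
      also have "\<dots> \<le> real_of_int (prefix_wt e n)" by (rule assms)
      finally show ?case using elim by (simp add: pos_le_divide_eq)
    qed
  qed
  finally have l: "ereal a \<le> liminf ?s" .
  moreover have "liminf ?s \<le> limsup ?s" by (rule Liminf_le_Limsup) simp
  ultimately show ?thesis unfolding avg_val_def Let_def by (cases \<Phi>) auto
qed

lemma avg_val_le: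
  assumes "\<And>n. real_of_int (prefix_wt e n) \<le> a * real n + C"
  shows "avg_val \<Phi> e \<le> ereal a"
proof -
  let ?s = "\<lambda>i. ereal (real_of_int (prefix_wt e i) / real i)"
  have "(\<lambda>n. a + C / real n) \<longlonglongrightarrow> a + 0"
    by (intro tendsto_intros lim_const_over_n)
  then have "(\<lambda>n. ereal (a + C / real n)) \<longlonglongrightarrow> ereal a"
    by simp
  then have eq: "ereal a = limsup (\<lambda>n. ereal (a + C / real n))"
    by (metis lim_imp_Limsup trivial_limit_sequentially)
  have "limsup ?s \<le> limsup (\<lambda>n. ereal (a + C / real n))"
  proof (rule Limsup_mono)
    show "\<forall>\<^sub>F n in sequentially. ?s n \<le> ereal (a + C / real n)"
      using eventually_gt_at_top[of 0]
    proof eventually_elim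
      case (elim n)
      have "real_of_int (prefix_wt e n) \<le> a * real n + C" by (rule assms)
      also have "\<dots> = (a + C / real n) * real n" using elim by (simp add: field_simps)
      finally show ?case using elim by (simp add: pos_divide_le_eq)
    qed
  qed
  then have l: "limsup ?s \<le> ereal a" using eq by simp
  moreover have "liminf ?s \<le> limsup ?s" by (rule Liminf_le_Limsup) simp
  ultimately show ?thesis unfolding avg_val_def Let_def by (cases \<Phi>) auto
qed

text \<open>The potential differences telescope. The factor \<open>L\<close> allows slopes below 1
  although weights and potentials are integers.\<close>

lemma sum_ge_potential:
  fixes L a M :: int and P u :: "nat \<Rightarrow> int"
  assumes L: "L > 0" and inc: "\<And>i. L * u i \<ge> P i - P (Suc i) + a"
    and bnd: "\<And>i. P i \<le> M"
  shows "real_of_int (\<Sum>i<n. u i) \<ge> (a / L) * real n - (M - P 0) / L"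
proof -
  have "L * (\<Sum>i<n. u i) \<ge> P 0 - P n + a * int n"
  proof (induction n)
    case (Suc n)
    then show ?case using inc[of n] by (simp add: algebra_simps)
  qed simp
  then have "L * (\<Sum>i<n. u i) \<ge> a * int n - (M - P 0)"
    using bnd[of n] by linarith
  then have "real_of_int (L * (\<Sum>i<n. u i)) \<ge> real_of_int (a * int n - (M - P 0))"
    by (simp only: of_int_le_iff)
  then have "real_of_int (\<Sum>i<n. u i) \<ge> (real_of_int a * real n - (M - P 0)) / L"
    using L by (simp add: pos_divide_le_eq mult.commute)
  then show ?thesis by (simp add: diff_divide_distrib)
qed

lemma sum_le_potential:
  fixes L a M :: int and P u :: "nat \<Rightarrow> int"
  assumes L: "L > 0" and dec: "\<And>i. L * u i \<le> P i - P (Suc i) - a"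
    and bnd: "\<And>i. P i \<ge> M"
  shows "real_of_int (\<Sum>i<n. u i) \<le> - (a / L) * real n + (P 0 - M) / L"
  using sum_ge_potential[where L = L and P = "\<lambda>i. - P i" and u = "\<lambda>i. - u i"
    and a = a and M = "- M" and n = n] L dec bnd
  by (simp add: sum_negf algebra_simps diff_divide_distrib)

subsection \<open>Plays against positional opponents\<close>

lemma is_history_snoc:
  assumes "is_history G h" "step G (last h) e cf"
  shows "is_history G (h @ [cf])"
  unfolding is_history_def
proof (intro conjI allI impI)
  have ne: "h \<noteq> []" using assms(1) by (simp add: is_history_def)
  show "h @ [cf] \<noteq> []" by simp
  show "(h @ [cf]) ! 0 = init_conf G" using assms(1) ne by (simp add: is_history_def nth_append)
  fix i assume i: "Suc i < length (h @ [cf])"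
  show "\<exists>e. step G ((h @ [cf]) ! i) e ((h @ [cf]) ! Suc i)"
  proof (cases "Suc i = length h")
    case True
    then have "h ! i = last h" using ne by (metis diff_Suc_1 last_conv_nth)
    with True assms(2) show ?thesis by (simp add: nth_append del: split_paired_Ex) blast
  next
    case False
    with i assms(1) show ?thesis by (auto simp: is_history_def nth_append)
  qed
qed

text \<open>As \<open>\<sigma>\<close> may look at the whole past, the recursion builds the
  histories \<open>H n\<close> and reads the play off their last entries. Player 2 follows
  \<open>\<mu>\<close> in state \<open>s\<close> and moves arbitrarily elsewhere.\<close>

lemma play_exists:
  assumes str: "strategy1 G \<sigma>"
    and tot: "\<And>h. is_history G h \<Longrightarrow> \<exists>e cf. step G (last h) e cf"
    and pol: "\<And>h. is_history G h \<Longrightarrow> snd (last h) = s \<Longrightarrow> \<exists>e. step G (last h) e (\<mu> (last h))"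
    and s: "s \<notin> set (p1 G)"
  obtains c e where "is_play G c e" "consistent G \<sigma> c" "\<And>i. snd (c i) = s \<Longrightarrow> c (Suc i) = \<mu> (c i)"
proof -
  define nxt where "nxt h = (if is_player1 G (last h) then \<sigma> h
    else if snd (last h) = s then \<mu> (last h) else (SOME cf. \<exists>e. step G (last h) e cf))" for h
  define H where "H = rec_nat [init_conf G] (\<lambda>_ h. h @ [nxt h])"
  have H0: "H 0 = [init_conf G]" and HS: "H (Suc n) = H n @ [nxt (H n)]" for n
    by (simp_all add: H_def)
  have legal: "\<exists>e. step G (last h) e (nxt h)" if h: "is_history G h" for h
  proof -
    have "\<exists>cf e. step G (last h) e cf" using tot[OF h] by blast
    then have "\<exists>e. step G (last h) e (SOME cf. \<exists>e. step G (last h) e cf)" by (rule someI_ex)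
    with pol[OF h] str h show ?thesis by (auto simp: nxt_def strategy1_def)
  qed
  have hist: "is_history G (H n)" for n
  proof (induction n)
    case 0
    show ?case by (simp add: H0 is_history_def)
  next
    case (Suc n)
    with legal[OF Suc] show ?case by (auto simp: HS intro: is_history_snoc)
  qed
  define c where "c n = last (H n)" for n
  have cS: "c (Suc n) = nxt (H n)" for n by (simp add: c_def HS)
  have Hc: "H n = map c [0..<Suc n]" for n
  proof (induction n)
    case 0
    show ?case by (simp add: H0 c_def)
  next
    case (Suc n)
    have "H (Suc n) = H n @ [c (Suc n)]" by (simp add: HS cS)
    then show ?case using Suc by simp
  qed
  have "\<forall>n. \<exists>e. step G (c n) e (c (Suc n))"
    using legal[OF hist] by (simp add: c_def[symmetric] cS)
  then obtain e where "\<forall>n. step G (c n) (e n) (c (Suc n))" by metis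
  then have "is_play G c e" by (simp add: is_play_def c_def H0)
  moreover have "consistent G \<sigma> c"
    unfolding consistent_def
  proof (intro allI impI)
    fix i assume "is_player1 G (c i)"
    then have "nxt (H i) = \<sigma> (H i)" by (simp add: nxt_def c_def)
    then show "c (Suc i) = \<sigma> (map c [0..<Suc i])" by (simp only: cS Hc[symmetric])
  qed
  moreover have "c (Suc i) = \<mu> (c i)" if "snd (c i) = s" for i
    using that s by (simp add: cS nxt_def c_def[symmetric] is_player1_def)
  ultimately show thesis by (rule that)
qed

text \<open>A positional strategy is implemented by a transducer with one state, so it settles both
  values of \<open>fm\<close>.\<close>

lemma positional_wins:
  assumes pol: "\<And>h. is_history G h \<Longrightarrow> snd (last h) = s \<Longrightarrow> \<exists>e. step G (last h) e (\<mu> (last h))"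
    and s: "set (p1 G) = {s}"
    and win: "\<And>c e. is_play G c e \<Longrightarrow> (\<And>i. snd (c i) = s \<Longrightarrow> c (Suc i) = \<mu> (c i)) \<Longrightarrow>
      objective \<Phi> r e \<and> (bnd \<longrightarrow> stack_bounded c)"
  shows "player1_wins G \<Phi> r bnd fm"
  unfolding player1_wins_def
proof (intro exI[of _ "\<lambda>h. \<mu> (last h)"] conjI allI impI)
  show "strategy1 G (\<lambda>h. \<mu> (last h))"
    using pol s by (auto simp: strategy1_def is_player1_def)
  show "finite_memory G (\<lambda>h. \<mu> (last h))"
    unfolding finite_memory_def
    by (intro exI[of _ "{0}"] exI[of _ 0] exI[of _ "\<lambda>_ _. 0"] exI[of _ "\<lambda>_. \<mu>"]) auto
next
  fix c e assume "is_play G c e \<and> consistent G (\<lambda>h. \<mu> (last h)) c"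
  then have p: "is_play G c e" and q: "\<And>i. snd (c i) = s \<Longrightarrow> c (Suc i) = \<mu> (c i)"
    using s by (auto simp: consistent_def is_player1_def)
  from win[OF p q] show "objective \<Phi> r e" "bnd \<Longrightarrow> stack_bounded c" by auto
qed

text \<open>The opponent \<open>\<mu>\<close> defeats every strategy of player 1, with finite memory
  or not.\<close>

lemma positional_spoils:
  assumes tot: "\<And>h. is_history G h \<Longrightarrow> \<exists>e cf. step G (last h) e cf"
    and pol: "\<And>h. is_history G h \<Longrightarrow> snd (last h) = s \<Longrightarrow> \<exists>e. step G (last h) e (\<mu> (last h))"
    and s: "s \<notin> set (p1 G)"
    and win: "\<And>c e. is_play G c e \<Longrightarrow> (\<And>i. snd (c i) = s \<Longrightarrow> c (Suc i) = \<mu> (c i)) \<Longrightarrow>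
      \<not> (objective \<Phi> r e \<and> (bnd \<longrightarrow> stack_bounded c))"
  shows "\<not> player1_wins G \<Phi> r bnd fm"
proof
  assume "player1_wins G \<Phi> r bnd fm"
  then obtain \<sigma> where str: "strategy1 G \<sigma>" and all: "\<And>c e. is_play G c e \<Longrightarrow> consistent G \<sigma> c \<Longrightarrow>
    objective \<Phi> r e \<and> (bnd \<longrightarrow> stack_bounded c)" unfolding player1_wins_def by blast
  from play_exists[OF str tot pol s] win all show False by metis
qed

subsection \<open>The simulation game\<close>

text \<open>State 0 belongs to the prover, who pushes the transitions of a run; after each push, in
  state 1, the challenger may attack the operation just performed. An attack leads to state
  \<open>2 * c + 2\<close> (the counter \<open>c\<close> was claimed to be zero) or \<open>2 * c + 3\<close> (claimed to be positive),
  where the stack is emptied while the weights add up the value of the counter. The stack symbol 0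
  doubles as the initial transition, and the fictitious counter \<open>K\<close>, constantly 1, makes
  the state \<open>2 * K + 3\<close> pay out a completed run.\<close>

definition chk :: "nat \<Rightarrow> nat" where
  "chk q = (q - 2) div 2"

definition sg :: "nat \<Rightarrow> int" where
  "sg q = (if odd q then 1 else - 1)"

fun target :: "opn \<Rightarrow> nat set" where
  "target (OInc c) = {}"
| "target (ODec c) = {2 * c + 3}"
| "target (OZero c) = {2 * c + 2}"

locale counter_game =
  fixes m K :: nat
    and src dst :: "nat \<Rightarrow> 'a" and opr :: "nat \<Rightarrow> opn" and fin :: 'a
    and V :: "nat \<Rightarrow> int" and d :: int
  assumes ctr_less: "\<And>g. 1 \<le> g \<Longrightarrow> g \<le> m \<Longrightarrow> ctr (opr g) < K"
    and V_nonneg: "\<And>c. V c \<ge> 0"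
    and V_K: "V K = 1"
begin

definition delta :: "nat \<Rightarrow> nat \<Rightarrow> int" where
  "delta c g = (if g = 0 then 0 else
     case opr g of OInc c' \<Rightarrow> if c = c' then 1 else 0
     | ODec c' \<Rightarrow> if c = c' then - 1 else 0
     | OZero c' \<Rightarrow> 0)"

definition moves :: "(nat \<times> nat \<times> nat \<times> com) set" where
  "moves = {(q, g, q', a). g \<le> m \<and>
     (q = 0 \<and> q' = 0 \<and> a = Skip \<or>
      q = 0 \<and> q' = 1 \<and> (\<exists>z. 1 \<le> z \<and> z \<le> m \<and> a = Push z \<and> src z = dst g) \<or>
      q = 0 \<and> q' = 2 * K + 3 \<and> a = Skip \<and> dst g = fin \<or>
      q = 1 \<and> q' = 0 \<and> a = Skip \<or>
      q = 1 \<and> g \<noteq> 0 \<and> a = Pop \<and> q' \<in> target (opr g) \<or>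
      2 \<le> q \<and> q < 2 * K + 4 \<and> g = 0 \<and> q' = 0 \<and> a = Skip \<or>
      2 \<le> q \<and> q < 2 * K + 4 \<and> g \<noteq> 0 \<and> q' = q \<and> a = Pop)}"

text \<open>A push costs 2, which the pops of the check pay back, corrected by twice the effect of
  each popped transition on the checked counter; the bottom edge adds the initial value. What
  remains of the check is \<open>sg q * (2 * val - 1)\<close> for the value at the attack, an odd
  number and so never a tie. Idling in state 0 costs 1, so that stalling does not help the
  prover.\<close>

fun wt :: "nat \<times> nat \<times> nat \<times> com \<Rightarrow> int" where
  "wt (q, g, q', a) =
     (if q = 0 then (if q' = 0 then - 1 else if q' = 1 then - 2 else 0)
      else if q = 1 then (if q' = 0 then 0 else 2)
      else if g = 0 then sg q * (2 * V (chk q) - 1)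
      else 2 + 2 * sg q * delta (chk q) g)"

fun add_wt :: "nat \<times> nat \<times> nat \<times> com \<Rightarrow> edge" where
  "add_wt (q, g, q', a) = (q, g, q', a, d * wt (q, g, q', a))"

definition val :: "nat list \<Rightarrow> nat \<Rightarrow> int" where
  "val \<alpha> c = V c + (\<Sum>g\<leftarrow>\<alpha>. delta c g)"

lemma val_Cons: "val (g # \<alpha>) c = delta c g + val \<alpha> c"
  by (simp add: val_def)

definition bad :: "nat \<Rightarrow> nat list \<Rightarrow> bool" where
  "bad g \<alpha> = (case opr g of OInc c \<Rightarrow> False | ODec c \<Rightarrow> val \<alpha> c \<le> 0 | OZero c \<Rightarrow> val \<alpha> c \<ge> 1)"

fun run :: "nat list \<Rightarrow> bool" where
  "run [] \<longleftrightarrow> False"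
| "run (g # \<alpha>) \<longleftrightarrow> (if \<alpha> = [] then g = 0
     else 1 \<le> g \<and> g \<le> m \<and> run \<alpha> \<and> src g = dst (hd \<alpha>) \<and> \<not> bad g \<alpha>)"

definition halts :: bool where
  "halts \<longleftrightarrow> (\<exists>\<alpha>. run \<alpha> \<and> dst (hd \<alpha>) = fin)"

lemma run_not_Nil: "run \<alpha> \<Longrightarrow> \<alpha> \<noteq> []"
  by auto

lemma run_suffix: "run \<alpha> \<Longrightarrow> suffix \<beta> \<alpha> \<Longrightarrow> \<beta> \<noteq> [] \<Longrightarrow> run \<beta>"
  by (induction \<alpha>) (auto simp: suffix_Cons split: if_splits)

text \<open>The weight still to be collected in the current round, up to the outcome of attacks.\<close>

fun psi :: "config \<Rightarrow> int" where
  "psi (\<alpha>, q) = 2 * int (length \<alpha>) - 2 +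
     (if q < 2 then 0 else sg q * (2 * val \<alpha> (chk q) - 1))"

text \<open>A clock that only runs backwards at the steps deciding a round.\<close>

fun tau :: "config \<Rightarrow> int" where
  "tau (\<alpha>, q) = (if q = 0 then 2 * int (length \<alpha>) else if q = 1 then 2 * int (length \<alpha>) - 1
     else - int (length \<alpha>))"

fun wfc :: "config \<Rightarrow> bool" where
  "wfc (\<alpha>, q) \<longleftrightarrow> \<alpha> \<noteq> [] \<and> last \<alpha> = 0 \<and> (\<forall>g\<in>set (butlast \<alpha>). 1 \<le> g \<and> g \<le> m) \<and> q < 2 * K + 4"

lemma abs_delta: "\<bar>delta c g\<bar> \<le> 1"
  by (auto simp: delta_def split: opn.split)

lemma val_bound: "\<alpha> \<noteq> [] \<Longrightarrow> last \<alpha> = 0 \<Longrightarrow> \<bar>val \<alpha> c - V c\<bar> \<le> int (length \<alpha>) - 1"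
proof (induction \<alpha>)
  case (Cons g \<alpha>)
  then show ?case using abs_delta[of c g]
    by (cases "\<alpha> = []") (auto simp: val_Cons, auto simp: val_def delta_def)
qed simp

lemma chk_le: "q < 2 * K + 4 \<Longrightarrow> chk q \<le> K"
  by (auto simp: chk_def)

lemma V_le: "c \<le> K \<Longrightarrow> V c \<le> (\<Sum>c\<le>K. V c)"
  by (rule member_le_sum) (auto simp: V_nonneg)

lemma abs_sg: "sg q = 1 \<or> sg q = - 1"
  by (auto simp: sg_def)

text \<open>Each symbol above the bottom adds 2 to the height term and changes twice the counter
  value by at most 2, so the heights cancel. A bound that does not depend on the stack is what
  controls plays with unbounded stacks.\<close>

lemma psi_ge: "wfc (\<alpha>, q) \<Longrightarrow> psi (\<alpha>, q) \<ge> - 2 * (\<Sum>c\<le>K. V c) - 1"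
  using V_le[OF chk_le, of q] val_bound[of \<alpha> "chk q"] V_nonneg[of "chk q"] abs_sg[of q]
  by (cases \<alpha>) auto

lemma psi_le: "wfc (\<alpha>, q) \<Longrightarrow> psi (\<alpha>, q) \<le> 4 * int (length \<alpha>) + 2 * (\<Sum>c\<le>K. V c) + 1"
  using V_le[OF chk_le, of q] val_bound[of \<alpha> "chk q"] V_nonneg[of "chk q"] abs_sg[of q]
  by (cases \<alpha>) auto

lemma wfc_hd: "wfc (\<alpha>, q) \<Longrightarrow> hd \<alpha> \<le> m"
  by (cases \<alpha>) (auto split: if_splits)

lemma wfc_hd_0: "wfc (\<alpha>, q) \<Longrightarrow> hd \<alpha> = 0 \<Longrightarrow> \<alpha> = [0]"
  by (cases \<alpha>) (auto split: if_splits)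

lemma val_K: "wfc (\<alpha>, q) \<Longrightarrow> val \<alpha> K = 1"
proof (induction \<alpha>)
  case (Cons g \<alpha>)
  show ?case
  proof (cases "\<alpha> = []")
    case True
    with Cons.prems show ?thesis by (simp add: val_def delta_def V_K)
  next
    case False
    with Cons.prems have g: "1 \<le> g" "g \<le> m" and wf: "wfc (\<alpha>, q)" by auto
    have "delta K g = 0" using ctr_less[OF g] by (cases "opr g") (auto simp: delta_def)
    with Cons.IH[OF wf] show ?thesis by (simp add: val_Cons)
  qed
qed simp

lemma run_wfc: "run \<alpha> \<Longrightarrow> q < 2 * K + 4 \<Longrightarrow> wfc (\<alpha>, q)"
  by (induction \<alpha>) (auto split: if_splits)

lemma target_outcome:
  assumes "q \<in> target (opr g)"
  shows "bad g \<alpha> \<Longrightarrow> sg q * (2 * val \<alpha> (chk q) - 1) \<le> - 1"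
    "\<not> bad g \<alpha> \<Longrightarrow> sg q * (2 * val \<alpha> (chk q) - 1) \<ge> 1"
  using assms by (cases "opr g"; auto simp: bad_def sg_def chk_def)+

lemma target_less: "q \<in> target (opr g) \<Longrightarrow> 1 \<le> g \<Longrightarrow> g \<le> m \<Longrightarrow> 2 \<le> q \<and> q < 2 * K + 4"
  using ctr_less[of g] by (cases "opr g") auto

text \<open>\<open>A\<close> is a halting run, rebuilt symbol by symbol from the bottom. The choice
  of \<open>g\<close> is unique, since a suffix is determined by its length. The last case keeps the
  move legal on histories that deviate from this policy.\<close>

fun honest :: "nat list \<Rightarrow> config \<Rightarrow> config" where
  "honest A (\<alpha>, q) = (if \<alpha> = A then (\<alpha>, 2 * K + 3)
     else if \<exists>g. suffix (g # \<alpha>) A then ((SOME g. suffix (g # \<alpha>) A) # \<alpha>, 1) else (\<alpha>, 0))"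

text \<open>Attacks exactly the forbidden operations; these have a singleton
  \<open>target\<close>.\<close>

fun challenge :: "config \<Rightarrow> config" where
  "challenge (\<alpha>, q) = (if hd \<alpha> \<noteq> 0 \<and> bad (hd \<alpha>) (tl \<alpha>)
     then (tl \<alpha>, the_elem (target (opr (hd \<alpha>)))) else (\<alpha>, 0))"

lemma honest_cases:
  assumes "suffix \<alpha> A"
  obtains "\<alpha> = A" "honest A (\<alpha>, q) = (\<alpha>, 2 * K + 3)"
  | g where "suffix (g # \<alpha>) A" "honest A (\<alpha>, q) = (g # \<alpha>, 1)"
proof (cases "\<alpha> = A")
  case False
  from assms obtain ys where "A = ys @ \<alpha>" by (auto simp: suffix_def)
  with False have "A = butlast ys @ last ys # \<alpha>" by (cases ys rule: rev_cases) auto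
  then have ex: "\<exists>g. suffix (g # \<alpha>) A" by (auto simp: suffix_def)
  from someI_ex[OF this] that(2) False ex show thesis by auto
qed (use that(1) in auto)

end

text \<open>For \<open>d = 1\<close> player 1 is the prover, for \<open>d = - 1\<close> the
  challenger with negated weights. The check states go to player 2 in both cases; they offer a
  single move for each top symbol, so their owner has no choice.\<close>

locale counter_arena = counter_game m K src dst opr fin V d
  for m K :: nat and src dst :: "nat \<Rightarrow> 'a" and opr fin V d +
  fixes G :: wpg
  assumes d: "d = 1 \<or> d = - 1"
    and nQ_G: "nQ G = 2 * K + 4" and nG_G: "nG G = Suc m" and init_G: "init G = 0"
    and edges_G: "set (edges G) = add_wt ` moves"
    and distinct_G: "distinct (map (\<lambda>(q, g, q', a, w). (q, g, q', a)) (edges G))"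
    and p1_G: "p1 G = [if d = 1 then 0 else 1]"
begin

lemma step_iff:
  "step G (\<alpha>, q) e (\<alpha>', q') \<longleftrightarrow> \<alpha> \<noteq> [] \<and> (\<exists>a. (q, hd \<alpha>, q', a) \<in> moves \<and>
     e = add_wt (q, hd \<alpha>, q', a) \<and> \<alpha>' = apply_com a \<alpha>)"
  unfolding step_def edges_G by force

lemma wf_G: "wf_wpg G"
  unfolding wf_wpg_def nQ_G nG_G init_G p1_G edges_G
proof (intro conjI)
  show "\<forall>(q, g, q', c, w)\<in>add_wt ` moves. q < 2 * K + 4 \<and> g < Suc m \<and> q' < 2 * K + 4 \<and>
      com_ok (Suc m) g c"
    using target_less by (fastforce simp: moves_def)
  show "\<forall>q<2 * K + 4. \<forall>g<Suc m. \<exists>(q1, g1, q', c, w)\<in>add_wt ` moves. q1 = q \<and> g1 = g"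
  proof (intro allI impI)
    fix q g assume qg: "q < 2 * K + 4" "g < Suc m"
    have "\<exists>q' a. (q, g, q', a) \<in> moves"
      using qg by (cases "q = 0"; cases "q = 1"; cases "g = 0") (auto simp: moves_def)
    then show "\<exists>(q1, g1, q', c, w)\<in>add_wt ` moves. q1 = q \<and> g1 = g" by force
  qed
qed (use distinct_G in \<open>auto\<close>)

text \<open>Most moves have exactly the drop of \<open>psi\<close> as weight and advance the clock
  \<open>tau\<close>. The exceptions are idling, which costs 1, and the two moves that decide a
  round: completing a run and attacking.\<close>

lemma step_cases:
  assumes st: "step G (\<alpha>, q) e (\<alpha>', q')" and wf: "wfc (\<alpha>, q)"
  obtains
    (neutral) "d * edge_wt e = psi (\<alpha>, q) - psi (\<alpha>', q')" "tau (\<alpha>', q') \<ge> tau (\<alpha>, q) + 1"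
      "q = 0 \<Longrightarrow> q' = 1 \<and> (\<exists>z. 1 \<le> z \<and> z \<le> m \<and> src z = dst (hd \<alpha>) \<and> \<alpha>' = z # \<alpha>)"
      "q = 1 \<Longrightarrow> q' = 0 \<and> \<alpha>' = \<alpha>"
      "2 \<le> q \<Longrightarrow> q' = 0 \<and> \<alpha>' = [0] \<and> \<alpha> = [0] \<or> q' = q \<and> \<alpha> = hd \<alpha> # \<alpha>' \<and> \<alpha>' \<noteq> []"
  | (wait) "d * edge_wt e = - 1" "q = 0" "q' = 0" "\<alpha>' = \<alpha>"
  | (finish) "d * edge_wt e = psi (\<alpha>, q) - psi (\<alpha>', q') + 1" "q = 0" "q' = 2 * K + 3" "\<alpha>' = \<alpha>"
      "dst (hd \<alpha>) = fin"
  | (attack) g where "\<alpha> = g # \<alpha>'" "\<alpha>' \<noteq> []" "q = 1" "q' \<in> target (opr g)"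
      "1 \<le> g" "g \<le> m" "2 \<le> q'" "q' < 2 * K + 4"
      "d * edge_wt e = psi (\<alpha>, q) - psi (\<alpha>', q') + sg q' * (2 * val \<alpha>' (chk q') - 1)"
proof -
  from st obtain a where a: "\<alpha> \<noteq> []" "(q, hd \<alpha>, q', a) \<in> moves"
    "e = add_wt (q, hd \<alpha>, q', a)" "\<alpha>' = apply_com a \<alpha>" by (auto simp: step_iff)
  have w: "d * edge_wt e = wt (q, hd \<alpha>, q', a)"
    using d by (auto simp: a(3) edge_wt_def)
  consider "q = 0" "q' = 0" "a = Skip"
    | z where "q = 0" "q' = 1" "1 \<le> z" "z \<le> m" "a = Push z" "src z = dst (hd \<alpha>)"
    | "q = 0" "q' = 2 * K + 3" "a = Skip" "dst (hd \<alpha>) = fin"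
    | "q = 1" "q' = 0" "a = Skip"
    | "q = 1" "hd \<alpha> \<noteq> 0" "a = Pop" "q' \<in> target (opr (hd \<alpha>))"
    | "2 \<le> q" "hd \<alpha> = 0" "q' = 0" "a = Skip"
    | "2 \<le> q" "hd \<alpha> \<noteq> 0" "q' = q" "a = Pop"
    using a(2) unfolding moves_def by auto
  then show thesis
  proof cases
    case 1
    then show thesis by (intro wait) (use w a in auto)
  next
    case 2
    then show thesis by (intro neutral) (use w a in auto)
  next
    case 3
    \<comment> \<open>The fictitious counter has value 1, so the check entered here is worth exactly
      \<open>2 * 1 - 1\<close>.\<close>
    have "chk (2 * K + 3) = K" "sg (2 * K + 3) = 1" by (auto simp: chk_def sg_def)
    with 3 show thesis by (intro finish) (use w a val_K[OF wf] in auto)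
  next
    case 4
    then show thesis by (intro neutral) (use w a in auto)
  next
    case 5
    define g where "g = hd \<alpha>"
    have \<alpha>: "\<alpha> = g # \<alpha>'" using a 5 by (auto simp: g_def)
    have ne: "\<alpha>' \<noteq> []" using wf 5 \<alpha> by auto
    have g: "1 \<le> g" "g \<le> m" using wfc_hd[OF wf] 5 by (auto simp: g_def)
    have t: "q' \<in> target (opr g)" using 5 by (simp add: g_def)
    note t' = target_less[OF t g]
    have "d * edge_wt e = psi (\<alpha>, q) - psi (\<alpha>', q') + sg q' * (2 * val \<alpha>' (chk q') - 1)"
      using w 5 t' \<alpha> by auto
    with \<alpha> ne g t t' 5(1) show thesis by (intro attack) auto
  next
    case 6
    with wfc_hd_0[OF wf] have \<alpha>: "\<alpha> = [0]" by simp
    with a 6 have \<alpha>': "\<alpha>' = [0]" by simp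
    show thesis
      by (rule neutral) (use w 6 \<alpha> \<alpha>' in \<open>auto simp: val_def delta_def\<close>)
  next
    case 7
    have \<alpha>: "\<alpha> = hd \<alpha> # \<alpha>'" using a 7 by auto
    have ne: "\<alpha>' \<noteq> []" using wf 7 \<alpha> by (metis last_ConsL wfc.simps)
    have v: "val \<alpha> (chk q) = delta (chk q) (hd \<alpha>) + val \<alpha>' (chk q)"
      by (subst \<alpha>) (rule val_Cons)
    have l: "length \<alpha> = Suc (length \<alpha>')" by (subst \<alpha>) simp
    show thesis
      by (rule neutral) (use w 7 v l \<alpha> ne in \<open>auto simp: algebra_simps\<close>)
  qed
qed

lemma step_wfc:
  assumes st: "step G (\<alpha>, q) e (\<alpha>', q')" and wf: "wfc (\<alpha>, q)"
  shows "wfc (\<alpha>', q')"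
  using st wf
proof (cases rule: step_cases)
  case neutral
  consider "q = 0" | "q = 1" | "2 \<le> q" by linarith
  then show ?thesis
  proof cases
    case 3
    then show ?thesis using neutral(5) wf by (cases \<alpha>) (auto split: if_splits)
  qed (use neutral wf in auto)
qed (use wf in \<open>auto split: if_splits\<close>)

lemma history_wfc: "is_history G h \<Longrightarrow> wfc (last h)"
proof -
  assume h: "is_history G h"
  have "wfc (h ! i)" if "i < length h" for i
    using that
  proof (induction i)
    case 0
    show ?case using h by (auto simp: is_history_def init_conf_def init_G)
  next
    case (Suc i)
    with h obtain e where "step G (h ! i) e (h ! Suc i)" by (auto simp: is_history_def)
    with Suc show ?case using step_wfc[of "fst (h ! i)" "snd (h ! i)"]
      by (metis Suc_lessD prod.collapse)
  qed
  with h show ?thesis by (auto simp: is_history_def last_conv_nth)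
qed

lemma play_wfc: "is_play G c e \<Longrightarrow> wfc (c i)"
proof (induction i)
  case 0
  then show ?case by (auto simp: is_play_def init_conf_def init_G)
next
  case (Suc i)
  then have "step G (c i) (e i) (c (Suc i))" by (simp add: is_play_def)
  with Suc show ?case by (metis prod.collapse step_wfc)
qed

lemma step_move:
  "wfc (\<alpha>, q) \<Longrightarrow> (q, hd \<alpha>, q', a) \<in> moves \<Longrightarrow> \<alpha>' = apply_com a \<alpha> \<Longrightarrow> \<exists>e. step G (\<alpha>, q) e (\<alpha>', q')"
  unfolding step_iff by auto

lemma step_total:
  assumes "is_history G h"
  shows "\<exists>e cf. step G (last h) e cf"
proof -
  obtain \<alpha> q where l: "last h = (\<alpha>, q)" by fastforce
  with history_wfc[OF assms] have wf: "wfc (\<alpha>, q)" by simp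
  then have "\<exists>q' a. (q, hd \<alpha>, q', a) \<in> moves"
    using wfc_hd[OF wf] by (cases "q = 0"; cases "q = 1"; cases "hd \<alpha> = 0") (auto simp: moves_def)
  with step_move[OF wf] l show ?thesis by metis
qed

lemma step_honest:
  assumes A: "run A" "dst (hd A) = fin" and h: "is_history G h" "snd (last h) = 0"
  shows "\<exists>e. step G (last h) e (honest A (last h))"
proof -
  obtain \<alpha> where l: "last h = (\<alpha>, 0)" using h(2) by (metis prod.collapse)
  with history_wfc[OF h(1)] have wf: "wfc (\<alpha>, 0)" by simp
  note hd = wfc_hd[OF wf]
  show ?thesis
  proof (cases "\<alpha> = A \<or> (\<exists>g. suffix (g # \<alpha>) A)")
    case True
    then have "suffix \<alpha> A" by (auto dest: suffix_ConsD)
    then show ?thesis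
    proof (cases rule: honest_cases[where q = 0])
      case 1
      then have "(0, hd \<alpha>, 2 * K + 3, Skip) \<in> moves" using A hd by (auto simp: moves_def)
      from step_move[OF wf this refl] 1 show ?thesis by (simp add: l)
    next
      case (2 g)
      then have "run (g # \<alpha>)" using run_suffix[OF A(1)] by blast
      then have "(0, hd \<alpha>, 1, Push g) \<in> moves" using hd wf by (auto simp: moves_def)
      from step_move[OF wf this refl] 2 show ?thesis by (simp add: l)
    qed
  next
    case False
    have "(0, hd \<alpha>, 0, Skip) \<in> moves" using hd by (auto simp: moves_def)
    from step_move[OF wf this refl] False show ?thesis by (simp add: l)
  qed
qed

lemma bad_target: "bad g \<alpha> \<Longrightarrow> the_elem (target (opr g)) \<in> target (opr g)"
  by (cases "opr g") (auto simp: bad_def)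

lemma step_challenge:
  assumes h: "is_history G h" "snd (last h) = 1"
  shows "\<exists>e. step G (last h) e (challenge (last h))"
proof -
  obtain \<alpha> where l: "last h = (\<alpha>, 1)" using h(2) by (metis prod.collapse)
  with history_wfc[OF h(1)] have wf: "wfc (\<alpha>, 1)" by simp
  note hd = wfc_hd[OF wf]
  show ?thesis
  proof (cases "hd \<alpha> \<noteq> 0 \<and> bad (hd \<alpha>) (tl \<alpha>)")
    case True
    with bad_target have "(1, hd \<alpha>, the_elem (target (opr (hd \<alpha>))), Pop) \<in> moves"
      using hd by (auto simp: moves_def)
    from step_move[OF wf this refl] True show ?thesis by (simp add: l)
  next
    case False
    have "(1, hd \<alpha>, 0, Skip) \<in> moves" using hd by (auto simp: moves_def)
    from step_move[OF wf this refl] False show ?thesis by (auto simp add: l)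
  qed
qed

section \<open>Payoff against the honest prover\<close>

lemma d_prefix_wt: "d * prefix_wt e n = (\<Sum>i<n. d * edge_wt (e i))"
  by (simp add: prefix_wt_def sum_distrib_left)

text \<open>In the check states the stack only shrinks, and the check ends with the stack
  \<open>[0]\<close>, which is again a suffix of \<open>A\<close>.\<close>

lemma honest_invariant:
  assumes A: "run A" "dst (hd A) = fin" and play: "is_play G c e"
    and pol: "\<And>i. snd (c i) = 0 \<Longrightarrow> c (Suc i) = honest A (c i)"
  shows "length (fst (c i)) \<le> length A \<and> (snd (c i) < 2 \<longrightarrow> suffix (fst (c i)) A)"
proof -
  have "last A = 0" using run_wfc[OF A(1), of 0] by simp
  then have 0: "suffix [0] A" using run_not_Nil[OF A(1)]
    by (metis append_butlast_last_id suffixI)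
  show ?thesis
  proof (induction i)
    case base: 0
    show ?case using 0 play suffix_length_le by (fastforce simp: is_play_def init_conf_def)
  next
    case (Suc i)
    obtain \<alpha> q where cf: "c i = (\<alpha>, q)" by fastforce
    obtain \<alpha>' q' where cf': "c (Suc i) = (\<alpha>', q')" by fastforce
    have st: "step G (\<alpha>, q) (e i) (\<alpha>', q')" using play cf cf' by (metis is_play_def)
    have wf: "wfc (\<alpha>, q)" using play_wfc[OF play, of i] cf by simp
    have len: "length \<alpha> \<le> length A" and suf: "q < 2 \<Longrightarrow> suffix \<alpha> A" using Suc cf by auto
    show ?case
    proof (cases "q = 0")
      case True
      then have hon: "honest A (\<alpha>, q) = (\<alpha>', q')" using pol[of i] cf cf' by simp
      from suf True have "suffix \<alpha> A" by simp
      then show ?thesis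
      proof (cases rule: honest_cases[where q = q])
        case 1
        with hon cf' show ?thesis by auto
      next
        case (2 g)
        with hon cf' show ?thesis by (auto dest: suffix_length_le)
      qed
    next
      case q: False
      from st wf show ?thesis
      proof (cases rule: step_cases)
        case neutral
        consider "q = 1" | "2 \<le> q" using q by linarith
        then show ?thesis
        proof cases
          case 1
          with neutral(4) len suf cf' show ?thesis by auto
        next
          case 2
          from neutral(5)[OF 2] show ?thesis
          proof
            assume "q' = 0 \<and> \<alpha>' = [0] \<and> \<alpha> = [0]"
            with 0 len cf' show ?thesis by auto
          next
            assume *: "q' = q \<and> \<alpha> = hd \<alpha> # \<alpha>' \<and> \<alpha>' \<noteq> []"
            then have "length \<alpha> = Suc (length \<alpha>')" by (metis length_Cons)
            with * len cf' 2 show ?thesis by auto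
          qed
        qed
      next
        case (attack g)
        with len cf' show ?thesis by auto
      qed (use q in auto)
    qed
  qed
qed

lemma honest_payoff:
  assumes A: "run A" "dst (hd A) = fin" and play: "is_play G c e"
    and pol: "\<And>i. snd (c i) = 0 \<Longrightarrow> c (Suc i) = honest A (c i)"
  shows "\<exists>a C. a > 0 \<and> (\<forall>n. real_of_int (d * prefix_wt e n) \<ge> a * real n - C)"
proof -
  note inv = honest_invariant[OF A play pol]
  \<comment> \<open>Completing or being attacked turns \<open>tau\<close> back by at most
    \<open>3 * length A\<close>. Scaled by \<open>L\<close>, the gain of 1 at such a step outweighs
    this with 1 to spare; the other steps gain 1 through the clock itself.\<close>
  define L where "L = 3 * int (length A) + 1"
  define P where "P i = L * psi (c i) + tau (c i)" for i
  define M where "M = L * (4 * int (length A) + 2 * (\<Sum>c\<le>K. V c) + 1) + 2 * int (length A)"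
  have L: "L > 0" by (simp add: L_def)
  have "L * (d * edge_wt (e i)) \<ge> P i - P (Suc i) + 1" for i
  proof -
    obtain \<alpha> q where cf: "c i = (\<alpha>, q)" by fastforce
    obtain \<alpha>' q' where cf': "c (Suc i) = (\<alpha>', q')" by fastforce
    have st: "step G (\<alpha>, q) (e i) (\<alpha>', q')" using play cf cf' by (metis is_play_def)
    have wf: "wfc (\<alpha>, q)" using play_wfc[OF play, of i] cf by simp
    have len: "length \<alpha> \<le> length A" and suf: "q < 2 \<Longrightarrow> suffix \<alpha> A" using inv[of i] cf by auto
    have slack: "L * (d * edge_wt (e i)) \<ge> P i - P (Suc i) + 1"
      if "d * edge_wt (e i) \<ge> psi (\<alpha>, q) - psi (\<alpha>', q') + 1" "tau (\<alpha>, q) - tau (\<alpha>', q') + 1 \<le> L"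
    proof -
      have "L * (d * edge_wt (e i)) \<ge> L * (psi (\<alpha>, q) - psi (\<alpha>', q') + 1)"
        using that(1) L by (intro mult_left_mono) auto
      then show ?thesis using that(2) unfolding P_def cf cf' by (simp only: algebra_simps)
    qed
    from st wf show ?thesis
    proof (cases rule: step_cases)
      case neutral
      have "L * (d * edge_wt (e i)) = L * (psi (\<alpha>, q) - psi (\<alpha>', q'))" using neutral(1) by simp
      then show ?thesis using neutral(2) unfolding P_def cf cf' by (simp only: algebra_simps)
    next
      case wait
      with pol[of i] cf cf' have hon: "honest A (\<alpha>, q) = (\<alpha>, 0)" by simp
      from suf wait have "suffix \<alpha> A" by simp
      \<comment> \<open>On a suffix of \<open>A\<close> the honest prover pushes or finishes, so
        idling is contradictory.\<close>
      then show ?thesis by (cases rule: honest_cases[where q = q]) (use hon in auto)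
    next
      case finish
      then show ?thesis by (intro slack) (use len in \<open>auto simp: L_def\<close>)
    next
      case (attack g)
      have "run \<alpha>" using run_suffix[OF A(1) suf] attack by auto
      then have "\<not> bad g \<alpha>'" using attack by simp
      from target_outcome(2)[OF attack(4) this] attack show ?thesis
        by (intro slack) (use len in \<open>auto simp: L_def\<close>)
    qed
  qed
  moreover have "P i \<le> M" for i
  proof -
    obtain \<alpha> q where cf: "c i = (\<alpha>, q)" by fastforce
    have wf: "wfc (\<alpha>, q)" using play_wfc[OF play, of i] cf by simp
    have len: "length \<alpha> \<le> length A" using inv[of i] cf by auto
    have "L * psi (\<alpha>, q) \<le> L * (4 * int (length A) + 2 * (\<Sum>c\<le>K. V c) + 1)"
      using psi_le[OF wf] len L by (intro mult_left_mono) auto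
    moreover have "tau (\<alpha>, q) \<le> 2 * int (length A)" using len by auto
    ultimately show ?thesis unfolding P_def M_def cf by linarith
  qed
  ultimately have "real_of_int (\<Sum>i<n. d * edge_wt (e i))
      \<ge> real_of_int 1 / L * real n - real_of_int (M - P 0) / L" for n
    by (intro sum_ge_potential[OF L])
  then show ?thesis unfolding d_prefix_wt using L
    by (intro exI[of _ "1 / L"] exI[of _ "(M - P 0) / L"]) simp
qed

section \<open>Payoff against the justified challenger\<close>

lemma challenge_invariant:
  assumes play: "is_play G c e"
    and pol: "\<And>i. snd (c i) = 1 \<Longrightarrow> c (Suc i) = challenge (c i)"
  shows "(snd (c i) = 0 \<longrightarrow> run (fst (c i))) \<and>
    (snd (c i) = 1 \<longrightarrow> (\<exists>g \<alpha>. fst (c i) = g # \<alpha> \<and> 1 \<le> g \<and> g \<le> m \<and> run \<alpha> \<and> src g = dst (hd \<alpha>)))"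
proof (induction i)
  case 0
  then show ?case using play by (simp add: is_play_def init_conf_def init_G)
next
  case (Suc i)
  obtain \<alpha> q where cf: "c i = (\<alpha>, q)" by fastforce
  obtain \<alpha>' q' where cf': "c (Suc i) = (\<alpha>', q')" by fastforce
  have st: "step G (\<alpha>, q) (e i) (\<alpha>', q')" using play cf cf' by (metis is_play_def)
  have wf: "wfc (\<alpha>, q)" using play_wfc[OF play, of i] cf by simp
  from st wf show ?case
  proof (cases rule: step_cases)
    case neutral
    consider "q = 0" | "q = 1" | "2 \<le> q" by linarith
    then show ?thesis
    proof cases
      case 1
      with neutral(3) Suc cf cf' show ?thesis by auto
    next
      case 2
      then obtain g \<beta> where g: "\<alpha> = g # \<beta>" "1 \<le> g" "g \<le> m" "run \<beta>" "src g = dst (hd \<beta>)"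
        using Suc cf by auto
      \<comment> \<open>The challenger let the transition pass, so it was allowed and the stack is a
        run again.\<close>
      have "challenge (\<alpha>, q) = (\<alpha>, 0)" using neutral(4)[OF 2] pol[of i] 2 cf cf' by simp
      then have "\<not> bad g \<beta>" using g by (auto split: if_splits)
      with g neutral(4)[OF 2] cf' show ?thesis by auto
    next
      case 3
      with neutral(5) cf' show ?thesis by auto
    qed
  next
    case wait
    with Suc cf cf' show ?thesis by auto
  qed (use cf' in auto)
qed

text \<open>The prover moves only on honest stacks, so without a halting run no round can be
  completed; attacks hit only forbidden operations. Hence every step that does not advance the clock
  loses at least 1.\<close>

lemma challenge_step:
  assumes nh: "\<not> halts" and play: "is_play G c e"
    and pol: "\<And>i. snd (c i) = 1 \<Longrightarrow> c (Suc i) = challenge (c i)"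
  shows "d * edge_wt (e i) = psi (c i) - psi (c (Suc i)) \<and> tau (c (Suc i)) \<ge> tau (c i) + 1 \<or>
    d * edge_wt (e i) \<le> psi (c i) - psi (c (Suc i)) - 1 \<and>
      tau (c i) - tau (c (Suc i)) \<le> 3 * int (length (fst (c i)))"
proof -
  note inv = challenge_invariant[OF play pol]
  obtain \<alpha> q where cf: "c i = (\<alpha>, q)" by fastforce
  obtain \<alpha>' q' where cf': "c (Suc i) = (\<alpha>', q')" by fastforce
  have st: "step G (\<alpha>, q) (e i) (\<alpha>', q')" using play cf cf' by (metis is_play_def)
  have wf: "wfc (\<alpha>, q)" using play_wfc[OF play, of i] cf by simp
  from st wf show ?thesis
  proof (cases rule: step_cases)
    case neutral
    then show ?thesis by (simp add: cf cf')
  next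
    case wait
    then show ?thesis by (simp add: cf cf')
  next
    case finish
    with inv[of i] nh cf show ?thesis by (auto simp: halts_def)
  next
    case (attack g)
    then have "challenge (\<alpha>, q) = (\<alpha>', q')" using pol[of i] cf cf' by simp
    then have "bad g \<alpha>'" using attack by (auto split: if_splits)
    from target_outcome(1)[OF attack(4) this] attack show ?thesis by (auto simp: cf cf')
  qed
qed

text \<open>Here \<open>psi\<close> alone is the potential, as it is bounded below uniformly in the
  stack height.\<close>

lemma challenge_payoff:
  assumes nh: "\<not> halts" and play: "is_play G c e"
    and pol: "\<And>i. snd (c i) = 1 \<Longrightarrow> c (Suc i) = challenge (c i)"
  shows "\<exists>C. \<forall>n. real_of_int (d * prefix_wt e n) \<le> 0 * real n + C"
proof -
  define M where "M = - 2 * (\<Sum>c\<le>K. V c) - 1"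
  have 1: "1 * (d * edge_wt (e i)) \<le> psi (c i) - psi (c (Suc i)) - 0" for i
    using challenge_step[OF nh play pol, of i] by auto
  have 2: "psi (c i) \<ge> M" for i
    using psi_ge[of "fst (c i)" "snd (c i)"] play_wfc[OF play, of i] by (simp add: M_def)
  from sum_le_potential[where P = "\<lambda>i. psi (c i)", OF zero_less_one 1 2] show ?thesis
    unfolding d_prefix_wt by (intro exI[of _ "real_of_int (psi (c 0) - M)"]) auto
qed

text \<open>A bounded height bounds the clock and its setbacks, which spreads the loss at the
  decisive steps over all steps; the clock enters with the opposite sign to the honest case.\<close>

lemma challenge_payoff_bounded:
  assumes nh: "\<not> halts" and play: "is_play G c e"
    and pol: "\<And>i. snd (c i) = 1 \<Longrightarrow> c (Suc i) = challenge (c i)"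
    and bnd: "stack_bounded c"
  shows "\<exists>a C. a > 0 \<and> (\<forall>n. real_of_int (d * prefix_wt e n) \<le> - a * real n + C)"
proof -
  from bnd obtain B where B: "\<And>i. length (fst (c i)) \<le> B" by (auto simp: stack_bounded_def)
  define L where "L = 3 * int B + 1"
  have L: "L > 0" by (simp add: L_def)
  define P where "P i = L * psi (c i) - tau (c i)" for i
  define M where "M = L * (- 2 * (\<Sum>c\<le>K. V c) - 1) - 2 * int B"
  have 1: "L * (d * edge_wt (e i)) \<le> P i - P (Suc i) - 1" for i
    using challenge_step[OF nh play pol, of i]
  proof
    assume *: "d * edge_wt (e i) = psi (c i) - psi (c (Suc i)) \<and> tau (c (Suc i)) \<ge> tau (c i) + 1"
    then have "L * (d * edge_wt (e i)) = L * psi (c i) - L * psi (c (Suc i))"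
      by (simp add: right_diff_distrib)
    with * show ?thesis unfolding P_def by linarith
  next
    assume *: "d * edge_wt (e i) \<le> psi (c i) - psi (c (Suc i)) - 1 \<and>
      tau (c i) - tau (c (Suc i)) \<le> 3 * int (length (fst (c i)))"
    then have "L * (d * edge_wt (e i)) \<le> L * (psi (c i) - psi (c (Suc i)) - 1)"
      using L by (intro mult_left_mono) auto
    moreover have "tau (c i) - tau (c (Suc i)) + 1 \<le> L" using * B[of i] by (simp add: L_def)
    ultimately show ?thesis unfolding P_def by (simp only: algebra_simps)
  qed
  have 2: "P i \<ge> M" for i
  proof -
    obtain \<alpha> q where cf: "c i = (\<alpha>, q)" by fastforce
    have wf: "wfc (\<alpha>, q)" using play_wfc[OF play, of i] cf by simp
    have "L * psi (\<alpha>, q) \<ge> L * (- 2 * (\<Sum>c\<le>K. V c) - 1)"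
      using psi_ge[OF wf] L by (intro mult_left_mono) auto
    moreover have "tau (\<alpha>, q) \<le> 2 * int B" using B[of i] cf by auto
    ultimately show ?thesis unfolding P_def M_def cf by linarith
  qed
  from sum_le_potential[where P = P, OF L 1 2]
  have "real_of_int (\<Sum>i<n. d * edge_wt (e i)) \<le> - (1 / L) * real n + (P 0 - M) / L" for n by simp
  then show ?thesis unfolding d_prefix_wt using L
    by (intro exI[of _ "1 / L"] exI[of _ "(P 0 - M) / L"]) simp
qed

text \<open>Without a halting run, sums bounded from above refute the strict objective, while a
  bounded stack forces a negative average and refutes the non-strict one too.\<close>

lemma prover_wins_iff:
  assumes d1: "d = 1" and "r = Gt \<or> bnd"
  shows "player1_wins G \<Phi> r bnd fm \<longleftrightarrow> halts"
proof (cases halts)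
  case True
  then obtain A where A: "run A" "dst (hd A) = fin" by (auto simp: halts_def)
  have "player1_wins G \<Phi> r bnd fm"
  proof (rule positional_wins[where s = 0 and \<mu> = "honest A"])
    fix c e assume play: "is_play G c e" and pol: "\<And>i. snd (c i) = 0 \<Longrightarrow> c (Suc i) = honest A (c i)"
    from honest_payoff[OF A play pol] obtain a C where a: "a > 0"
      and ge: "\<And>n. real_of_int (prefix_wt e n) \<ge> a * real n - C" by (auto simp: d1)
    from avg_val_ge[OF ge, of \<Phi>] a have "avg_val \<Phi> e > 0"
      by (metis ereal_less(2) less_le_trans)
    moreover have "stack_bounded c"
      using honest_invariant[OF A play pol] by (auto simp: stack_bounded_def)
    ultimately show "objective \<Phi> r e \<and> (bnd \<longrightarrow> stack_bounded c)"
      by (cases r) (auto simp: objective_def)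
  qed (use step_honest[OF A] p1_G d1 in auto)
  with True show ?thesis by simp
next
  case False
  have "\<not> player1_wins G \<Phi> r bnd fm"
  proof (rule positional_spoils[where s = 1 and \<mu> = challenge])
    fix c e assume play: "is_play G c e" and pol: "\<And>i. snd (c i) = 1 \<Longrightarrow> c (Suc i) = challenge (c i)"
    show "\<not> (objective \<Phi> r e \<and> (bnd \<longrightarrow> stack_bounded c))"
    proof (cases r)
      case Gt
      from challenge_payoff[OF False play pol] obtain C where
        "\<And>n. real_of_int (prefix_wt e n) \<le> 0 * real n + C" by (auto simp: d1)
      from avg_val_le[OF this, of \<Phi>] have "avg_val \<Phi> e \<le> 0" by (simp add: zero_ereal_def)
      then show ?thesis using Gt by (auto simp: objective_def)
    next
      case Geq
      show ?thesis
      proof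
        assume *: "objective \<Phi> r e \<and> (bnd \<longrightarrow> stack_bounded c)"
        with Geq assms(2) have "stack_bounded c" by simp
        from challenge_payoff_bounded[OF False play pol this] obtain a C where a: "a > 0"
          and "\<And>n. real_of_int (prefix_wt e n) \<le> - a * real n + C" by (auto simp: d1)
        from avg_val_le[OF this(2), of \<Phi>] have "avg_val \<Phi> e \<le> ereal (- a)" .
        also have "\<dots> < 0" using a by simp
        finally show False using * Geq by (auto simp: objective_def)
      qed
    qed
  qed (use step_total step_challenge p1_G d1 in auto)
  with False show ?thesis by simp
qed

text \<open>Covers the case left open by \<open>prover_wins_iff\<close>: after negation, the
  challenger keeps the sums bounded from below, which is enough for a non-strict objective.\<close>

lemma challenger_wins_iff:
  assumes d1: "d = - 1"
  shows "player1_wins G \<Phi> Geq False fm \<longleftrightarrow> \<not> halts"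
proof (cases halts)
  case True
  then obtain A where A: "run A" "dst (hd A) = fin" by (auto simp: halts_def)
  have "\<not> player1_wins G \<Phi> Geq False fm"
  proof (rule positional_spoils[where s = 0 and \<mu> = "honest A"])
    fix c e assume play: "is_play G c e" and pol: "\<And>i. snd (c i) = 0 \<Longrightarrow> c (Suc i) = honest A (c i)"
    from honest_payoff[OF A play pol] obtain a C where a: "a > 0"
      and ge: "\<And>n. real_of_int (d * prefix_wt e n) \<ge> a * real n - C" by auto
    have "real_of_int (prefix_wt e n) \<le> - a * real n + C" for n
      using ge[of n] by (simp add: d1)
    from avg_val_le[OF this, of \<Phi>] have "avg_val \<Phi> e \<le> ereal (- a)" .
    also have "\<dots> < 0" using a by simp
    finally show "\<not> (objective \<Phi> Geq e \<and> (False \<longrightarrow> stack_bounded c))"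
      by (simp add: objective_def)
  qed (use step_total step_honest[OF A] p1_G d1 in auto)
  with True show ?thesis by simp
next
  case False
  have "player1_wins G \<Phi> Geq False fm"
  proof (rule positional_wins[where s = 1 and \<mu> = challenge])
    fix c e assume play: "is_play G c e" and pol: "\<And>i. snd (c i) = 1 \<Longrightarrow> c (Suc i) = challenge (c i)"
    from challenge_payoff[OF False play pol] obtain C where
      C: "\<And>n. real_of_int (d * prefix_wt e n) \<le> 0 * real n + C" by blast
    have "real_of_int (prefix_wt e n) \<ge> 0 * real n - C" for n
      using C[of n] by (simp add: d1)
    from avg_val_ge[OF this, of \<Phi>] show "objective \<Phi> Geq e \<and> (False \<longrightarrow> stack_bounded c)"
      by (simp add: objective_def zero_ereal_def)
  qed (use step_challenge p1_G d1 in auto)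
  with False show ?thesis by simp
qed

end

subsection \<open>Programs as counter automata\<close>

text \<open>The symbols from 1 to \<open>m\<close> enumerate the transitions; symbol 0 leads to the
  start. With \<open>3 \<le> K\<close> the three input registers are genuine counters, distinct from
  the fictitious one.\<close>

lemma program_automaton:
  fixes D :: "ins list"
  obtains m K :: nat and src dst :: "nat \<Rightarrow> ins list" and opr :: "nat \<Rightarrow> opn"
  where "3 \<le> K" "\<And>g. 1 \<le> g \<Longrightarrow> g \<le> m \<Longrightarrow> ctr (opr g) < K" "dst 0 = D"
    "\<And>g. 1 \<le> g \<Longrightarrow> g \<le> m \<Longrightarrow> (opr g, dst g) \<in> succs (src g)"
    "\<And>g x s. g \<le> m \<Longrightarrow> (x, s) \<in> succs (dst g) \<Longrightarrow>
       \<exists>g'. 1 \<le> g' \<and> g' \<le> m \<and> src g' = dst g \<and> opr g' = x \<and> dst g' = s"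
proof -
  define S where "S = insert [] (conts D [])"
  define T where "T = (SIGMA s : S. succs s)"
  have fin_succs: "finite (succs s)" for s by (cases s rule: succs.cases) auto
  have "finite T" unfolding T_def S_def
    by (intro finite_SigmaI) (auto simp: finite_conts fin_succs)
  then obtain ts where ts: "set ts = T" using finite_list by blast
  have "finite ((ctr \<circ> fst \<circ> snd) ` T)" using \<open>finite T\<close> by simp
  then obtain K0 where K0: "\<And>x. x \<in> (ctr \<circ> fst \<circ> snd) ` T \<Longrightarrow> x < K0"
    by (auto simp: finite_nat_set_iff_bounded)
  have D: "D \<in> S" using conts_start(2)[of D "[]"] by (simp add: S_def)
  have closed: "s' \<in> S" if "s \<in> S" "(x, s') \<in> succs s" for s x s'
    using that conts_closed(2)[of s D "[]" x s'] by (auto simp: S_def)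
  show thesis
  proof (rule that[where m = "length ts" and K = "max 3 K0" and src = "\<lambda>g. fst (ts ! (g - 1))"
        and opr = "\<lambda>g. fst (snd (ts ! (g - 1)))"
        and dst = "\<lambda>g. if g = 0 then D else snd (snd (ts ! (g - 1)))"])
    have inT: "ts ! (g - 1) \<in> T" if "1 \<le> g" "g \<le> length ts" for g
      using that ts by (metis One_nat_def Suc_le_lessD Suc_pred nth_mem)
    show "ctr (fst (snd (ts ! (g - 1)))) < max 3 K0" if "1 \<le> g" "g \<le> length ts" for g
      using K0[of "ctr (fst (snd (ts ! (g - 1))))"] inT[OF that] by force
    show "(fst (snd (ts ! (g - 1))), if g = 0 then D else snd (snd (ts ! (g - 1))))
        \<in> succs (fst (ts ! (g - 1)))" if "1 \<le> g" "g \<le> length ts" for g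
      using inT[OF that] that by (auto simp: T_def)
    fix g x s
    assume g: "g \<le> length ts" and s: "(x, s) \<in> succs (if g = 0 then D else snd (snd (ts ! (g - 1))))"
      (is "_ \<in> succs ?s")
    have "?s \<in> S"
      using D inT[of g] g closed by (auto simp: T_def)
    with s have "(?s, x, s) \<in> set ts" by (simp add: ts T_def)
    then obtain j where "j < length ts" "ts ! j = (?s, x, s)" by (metis in_set_conv_nth)
    then show "\<exists>g'. 1 \<le> g' \<and> g' \<le> length ts \<and> fst (ts ! (g' - 1)) = ?s \<and>
        fst (snd (ts ! (g' - 1))) = x \<and> (if g' = 0 then D else snd (snd (ts ! (g' - 1)))) = s"
      by (intro exI[of _ "Suc j"]) simp
  qed auto
qed

locale program_game = counter_game m K src dst opr fin V d
  for m K :: nat and src dst :: "nat \<Rightarrow> ins list" and opr fin V d +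
  fixes D :: "ins list" and v0 :: "nat \<Rightarrow> nat"
  assumes dst_0: "dst 0 = D" and fin: "fin = []"
    and sound: "\<And>g. 1 \<le> g \<Longrightarrow> g \<le> m \<Longrightarrow> (opr g, dst g) \<in> succs (src g)"
    and complete: "\<And>g x s. g \<le> m \<Longrightarrow> (x, s) \<in> succs (dst g) \<Longrightarrow>
       \<exists>g'. 1 \<le> g' \<and> g' \<le> m \<and> src g' = dst g \<and> opr g' = x \<and> dst g' = s"
    and V_v0: "\<And>c. c < K \<Longrightarrow> V c = int (v0 c)"
begin

text \<open>As \<open>exec\<close> relates only initial and final valuations, reaching a
  configuration is expressed by saying that every execution from it is also an outcome of
  \<open>D\<close>.\<close>

lemma run_exec:
  "run \<alpha> \<Longrightarrow> \<exists>v. (\<forall>c<K. val \<alpha> c = int (v c)) \<and> (\<forall>w. exec (dst (hd \<alpha>)) v w \<longrightarrow> exec D v0 w)"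
proof (induction \<alpha>)
  case (Cons g \<alpha>)
  show ?case
  proof (cases "\<alpha> = []")
    case True
    with Cons.prems show ?thesis
      by (intro exI[of _ v0]) (auto simp: val_def delta_def V_v0 dst_0)
  next
    case False
    with Cons.prems have g: "1 \<le> g" "g \<le> m" "run \<alpha>" "src g = dst (hd \<alpha>)" "\<not> bad g \<alpha>" by auto
    from Cons.IH[OF g(3)] obtain v where v: "\<And>c. c < K \<Longrightarrow> val \<alpha> c = int (v c)"
      "\<And>w. exec (src g) v w \<Longrightarrow> exec D v0 w" using g(4) by auto
    note cK = ctr_less[OF g(1,2)]
    have s: "(opr g, dst g) \<in> succs (src g)" using sound[OF g(1,2)] .
    show ?thesis
    proof (cases "opr g")
      case (OInc c)
      with s have "src g = Inc c # dst g" by (cases "src g" rule: succs.cases) auto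
      then have "exec D v0 w" if "exec (dst g) (v(c := Suc (v c))) w" for w
        using v(2) exec_Inc[OF that] by simp
      moreover have "val (g # \<alpha>) c' = int ((v(c := Suc (v c))) c')" if "c' < K" for c'
        using v(1)[OF that] OInc g(1) by (simp add: val_Cons delta_def)
      ultimately show ?thesis unfolding list.sel by blast
    next
      case (OZero c)
      with s obtain b where src: "src g = Loop c b # dst g" by (cases "src g" rule: succs.cases) auto
      have "v c = 0" using g(5) v(1)[of c] cK OZero by (simp add: bad_def)
      then have "exec D v0 w" if "exec (dst g) v w" for w
        using v(2) exec_Exit[OF _ that] src by simp
      moreover have "val (g # \<alpha>) c' = int (v c')" if "c' < K" for c'
        using v(1)[OF that] OZero g(1) by (simp add: val_Cons delta_def)
      ultimately show ?thesis unfolding list.sel by blast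
    next
      case (ODec c)
      with s obtain b k where src: "src g = Loop c b # k" "dst g = b @ Loop c b # k"
        by (cases "src g" rule: succs.cases) auto
      obtain n where n: "v c = Suc n"
        using g(5) v(1)[of c] cK ODec by (cases "v c") (auto simp: bad_def)
      have "exec D v0 w" if "exec (dst g) (v(c := n)) w" for w
        using v(2) exec_Enter[OF n that[unfolded src]] src by simp
      moreover have "val (g # \<alpha>) c' = int ((v(c := n)) c')" if "c' < K" for c'
        using v(1)[OF that] ODec g(1) n by (simp add: val_Cons delta_def)
      ultimately show ?thesis unfolding list.sel by blast
    qed
  qed
qed simp

lemma run_hd: "run \<alpha> \<Longrightarrow> hd \<alpha> \<le> m"
  using wfc_hd[OF run_wfc[of \<alpha> 0]] by simp

text \<open>Each step of the execution passes its guard, so it extends the stack by an allowed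
  transition, supplied by \<open>complete\<close>.\<close>

lemma exec_halts:
  "exec s v w \<Longrightarrow> run \<alpha> \<Longrightarrow> dst (hd \<alpha>) = s \<Longrightarrow> (\<And>c. c < K \<Longrightarrow> val \<alpha> c = int (v c)) \<Longrightarrow> halts"
proof (induction arbitrary: \<alpha> rule: exec.induct)
  case (exec_Nil v)
  then show ?case unfolding halts_def using fin by auto
next
  case (exec_Inc k v r v')
  have "hd \<alpha> \<le> m" using run_hd[OF exec_Inc.prems(1)] .
  with complete[of "hd \<alpha>" "OInc r" k] exec_Inc.prems(2) obtain g where
    g: "1 \<le> g" "g \<le> m" "src g = dst (hd \<alpha>)" "opr g = OInc r" "dst g = k" by auto
  show ?case
    by (intro exec_Inc.IH[of "g # \<alpha>"])
      (use g exec_Inc.prems(1) exec_Inc.prems(3) exec_Inc.hyps run_not_Nil[of \<alpha>] in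
        \<open>simp_all add: bad_def val_Cons delta_def\<close>)
next
  case (exec_Exit v r k v' b)
  have "hd \<alpha> \<le> m" using run_hd[OF exec_Exit.prems(1)] .
  with complete[of "hd \<alpha>" "OZero r" k] exec_Exit.prems(2) obtain g where
    g: "1 \<le> g" "g \<le> m" "src g = dst (hd \<alpha>)" "opr g = OZero r" "dst g = k" by auto
  have "val \<alpha> r = 0" using exec_Exit.prems(3)[of r] ctr_less[OF g(1,2)] g(4) exec_Exit.hyps by simp
  then show ?case
    by (intro exec_Exit.IH[of "g # \<alpha>"])
      (use g exec_Exit.prems(1) exec_Exit.prems(3) exec_Exit.hyps run_not_Nil[of \<alpha>] in
        \<open>simp_all add: bad_def val_Cons delta_def\<close>)
next
  case (exec_Enter v r n b k v')
  have "hd \<alpha> \<le> m" using run_hd[OF exec_Enter.prems(1)] .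
  with complete[of "hd \<alpha>" "ODec r" "b @ Loop r b # k"] exec_Enter.prems(2) obtain g where
    g: "1 \<le> g" "g \<le> m" "src g = dst (hd \<alpha>)" "opr g = ODec r" "dst g = b @ Loop r b # k" by auto
  have "val \<alpha> r = 1 + int n"
    using exec_Enter.prems(3)[of r] ctr_less[OF g(1,2)] g(4) exec_Enter.hyps by simp
  then show ?case
    by (intro exec_Enter.IH[of "g # \<alpha>"])
      (use g exec_Enter.prems(1) exec_Enter.prems(3) exec_Enter.hyps run_not_Nil[of \<alpha>] in
        \<open>simp_all add: bad_def val_Cons delta_def\<close>)
qed

lemma halts_iff_exec: "halts \<longleftrightarrow> (\<exists>v. exec D v0 v)"
proof
  assume halts
  then obtain \<alpha> where "run \<alpha>" "dst (hd \<alpha>) = []"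
    unfolding halts_def using fin by auto
  with run_exec[of \<alpha>] exec_Nil show "\<exists>v. exec D v0 v" by metis
next
  assume "\<exists>v. exec D v0 v"
  then show halts using exec_halts[of D v0 _ "[0]"] by (auto simp: dst_0 val_def delta_def V_v0)
qed

end

lemma Loop_Inc_diverges: "exec [Loop a [Inc a]] v w \<Longrightarrow> v a = 0"
proof -
  \<comment> \<open>The second conjunct handles the program point inside the loop: its increment
    returns to the loop with a positive register, against the first conjunct.\<close>
  have "exec p v w \<Longrightarrow> (p = [Loop a [Inc a]] \<longrightarrow> v a = 0) \<and> p \<noteq> [Inc a, Loop a [Inc a]]" for p v
    by (induction rule: exec.induct) auto
  then show "exec [Loop a [Inc a]] v w \<Longrightarrow> v a = 0" by blast
qed

subsection \<open>Computing the encoding of the game\<close>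

text \<open>\<open>int_encode\<close> maps \<open>n \<ge> 0\<close> to \<open>2 * n\<close> and
  \<open>- n\<close> with \<open>n > 0\<close> to \<open>2 * n - 1\<close>; here \<open>y\<close>
  stands for \<open>2 * x - 1\<close>.\<close>

definition rweight :: "int \<Rightarrow> recf \<Rightarrow> recf" where
  "rweight s a = (let y = Comp rpred [Comp radd [a, a]]; z = Comp radd [y, y] in
     if s = 1 then z else Comp rpred [z])"

lemma eval_rweight:
  assumes "s = 1 \<or> s = - 1" "eval_recf a xs x" "x \<ge> 1"
  shows "eval_recf (rweight s a) xs (int_encode (s * (2 * int x - 1)))"
proof -
  let ?y = "x + x - 1"
  have z: "eval_recf (Comp radd [Comp rpred [Comp radd [a, a]], Comp rpred [Comp radd [a, a]]]) xs (?y + ?y)"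
    by (intro eval_Comp2[OF _ _ eval_radd] eval_Comp1[OF _ eval_rpred] assms(2))
  have n: "nat (2 * int x - 1) = ?y" "nat (2 * int x - 2) = ?y - 1" using assms(3) by auto
  from assms(1) show ?thesis
  proof
    assume "s = 1"
    moreover have "int_encode (2 * int x - 1) = ?y + ?y"
      using assms(3) n(1) by (simp add: int_encode_def sum_encode_def)
    ultimately show ?thesis using z by (simp add: rweight_def Let_def)
  next
    assume s: "s = - 1"
    moreover have "int_encode (1 - 2 * int x) = ?y + ?y - 1"
      using assms(3) n(2) by (simp add: int_encode_def sum_encode_def)
    ultimately show ?thesis using eval_Comp1[OF z eval_rpred] by (simp add: rweight_def Let_def)
  qed
qed

definition redge :: "int \<Rightarrow> nat \<Rightarrow> recf \<Rightarrow> recf" where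
  "redge s q a = rpair (rconst q) (rpair Zero (rpair Zero (rpair Zero (rweight s a))))"

lemma eval_redge:
  assumes "s = 1 \<or> s = - 1" "eval_recf a xs x" "x \<ge> 1"
  shows "eval_recf (redge s q a) xs (enc_edge (q, 0, 0, Skip, s * (2 * int x - 1)))"
  unfolding redge_def enc_edge_def
  by (auto intro!: eval_rpair eval_rconst eval_rweight[OF assms] eval_recf.intros(1))

definition redges :: "int \<Rightarrow> nat list \<Rightarrow> recf" where
  "redges d qs = foldr (\<lambda>q R. rcons (redge (d * sg q) q (Proj (chk q))) R) qs (Proj 2)"

lemma eval_redges:
  assumes d: "d = 1 \<or> d = - 1" and xs: "length xs = 3" "\<And>i. i < 3 \<Longrightarrow> xs ! i \<ge> 1"
    and rest: "xs ! 2 = list_encode (map enc_edge rest)" and qs: "\<And>q. q \<in> set qs \<Longrightarrow> chk q < 3"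
  shows "eval_recf (redges d qs) xs (list_encode (map enc_edge
    (map (\<lambda>q. (q, 0, 0, Skip, d * sg q * (2 * int (xs ! chk q) - 1))) qs @ rest)))"
  using qs
proof (induction qs)
  case Nil
  show ?case using rest xs by (auto simp: redges_def intro: eval_Proj)
next
  case (Cons q qs)
  have q: "chk q < 3" using Cons.prems by simp
  have "eval_recf (redge (d * sg q) q (Proj (chk q))) xs
      (enc_edge (q, 0, 0, Skip, d * sg q * (2 * int (xs ! chk q) - 1)))"
    by (rule eval_redge) (use d xs q in \<open>auto simp: sg_def intro: eval_Proj\<close>)
  from eval_rcons[OF this Cons.IH] Cons.prems show ?case by (simp add: redges_def)
qed

text \<open>The inputs are the number of states, the number of symbols and the code of the edges
  whose weights do not depend on the inputs. The states in \<open>[2..<8]\<close> check the counters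
  0, 1 and 2, which hold these same inputs.\<close>

definition rgame :: "int \<Rightarrow> recf" where
  "rgame d = rpair (Proj 0) (rpair (Proj 1) (rpair Zero
     (rpair (redges d [2..<8]) (rcons (rconst (if d = 1 then 0 else 1)) Zero))))"

lemma eval_rgame:
  assumes d: "d = 1 \<or> d = - 1" and xs: "length xs = 3" "\<And>i. i < 3 \<Longrightarrow> xs ! i \<ge> 1"
    and rest: "xs ! 2 = list_encode (map enc_edge rest)"
  shows "eval_recf (rgame d) xs (enc_wpg (WPG (xs ! 0) (xs ! 1) 0
    (map (\<lambda>q. (q, 0, 0, Skip, d * sg q * (2 * int (xs ! chk q) - 1))) [2..<8] @ rest)
    [if d = 1 then 0 else 1]))"
proof -
  have 1: "eval_recf (redges d [2..<8]) xs (list_encode (map enc_edge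
    (map (\<lambda>q. (q, 0, 0, Skip, d * sg q * (2 * int (xs ! chk q) - 1))) [2..<8] @ rest)))"
    by (rule eval_redges[OF d xs rest]) (auto simp: chk_def)
  have 2: "eval_recf (rcons (rconst p) Zero) xs (list_encode [p])" for p
    using eval_rcons[of "rconst p" xs "\<lambda>x. x" p Zero "[]"] eval_rconst eval_recf.intros(1)[of xs] by simp
  show ?thesis unfolding rgame_def enc_wpg_def wpg.sel
    by (intro eval_rpair eval_Proj eval_recf.intros(1) 1 2) (use xs in auto)
qed

subsection \<open>Diagonalization\<close>

lemma game_for_program:
  fixes D :: "ins list" and d :: int
  assumes d: "d = 1 \<or> d = - 1"
  obtains xs G where "wf_wpg G" "length xs = 3" "eval_recf (rgame d) xs (enc_wpg G)"
    "\<And>\<Phi> r bnd fm. d = 1 \<Longrightarrow> r = Gt \<or> bnd \<Longrightarrow>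
      player1_wins G \<Phi> r bnd fm \<longleftrightarrow> (\<exists>v. exec D (\<lambda>c. if c < 3 then xs ! c else 0) v)"
    "\<And>\<Phi> fm. d = - 1 \<Longrightarrow>
      player1_wins G \<Phi> Geq False fm \<longleftrightarrow> \<not> (\<exists>v. exec D (\<lambda>c. if c < 3 then xs ! c else 0) v)"
proof -
  obtain m K and src dst :: "nat \<Rightarrow> ins list" and opr where K: "3 \<le> K"
    and ctr: "\<And>g. 1 \<le> g \<Longrightarrow> g \<le> m \<Longrightarrow> ctr (opr g) < K" and dst: "dst 0 = D"
    and sound: "\<And>g. 1 \<le> g \<Longrightarrow> g \<le> m \<Longrightarrow> (opr g, dst g) \<in> succs (src g)"
    and complete: "\<And>g x s. g \<le> m \<Longrightarrow> (x, s) \<in> succs (dst g) \<Longrightarrow>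
       \<exists>g'. 1 \<le> g' \<and> g' \<le> m \<and> src g' = dst g \<and> opr g' = x \<and> dst g' = s"
    by (rule program_automaton[of D]) (rule that, assumption+)
  \<comment> \<open>The inputs contain the code of the other edges, so these must be fixed before
    the initial counter values are known. They are therefore built with all inputs 0; the fictitious
    counter already has its value 1.\<close>
  define V0 :: "nat \<Rightarrow> int" where "V0 c = (if c = K then 1 else 0)" for c
  interpret I0: counter_game m K src dst opr "[]" V0 d
    by unfold_locales (auto simp: ctr V0_def)
  define pm :: "(nat \<times> nat \<times> nat \<times> com) list" where "pm = map (\<lambda>q. (q, 0, 0, Skip)) [2..<8]"
  have "I0.moves \<subseteq> {..<2 * K + 4} \<times> {..m} \<times> {..<2 * K + 4} \<times> ({Skip, Pop} \<union> Push ` {..m})"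
    using I0.target_less by (fastforce simp: I0.moves_def)
  then have "finite (I0.moves - set pm)" by (auto intro: finite_subset)
  then obtain rm where rm: "set rm = I0.moves - set pm" "distinct rm"
    using finite_distinct_list by blast
  define rest where "rest = map I0.add_wt rm"
  define xs where "xs = [2 * K + 4, Suc m, list_encode (map enc_edge rest)]"
  have "(0, 0, 0, Skip) \<in> set rm" by (auto simp: rm I0.moves_def pm_def)
  \<comment> \<open>A nonempty list has a positive code, as the encoding of the weights
    requires.\<close>
  then have "rest \<noteq> []" by (auto simp: rest_def)
  then have pos: "xs ! i \<ge> 1" if "i < 3" for i
    using that by (auto simp: xs_def less_Suc_eq numeral_3_eq_3 neq_Nil_conv)
  define v0 where "v0 c = (if c < 3 then xs ! c else 0)" for c
  define V :: "nat \<Rightarrow> int" where "V c = (if c = K then 1 else int (v0 c))" for c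
  interpret I: counter_game m K src dst opr "[]" V d
    by unfold_locales (auto simp: ctr V_def)
  define G where "G = WPG (2 * K + 4) (Suc m) 0 (map I.add_wt (pm @ rm)) [if d = 1 then 0 else 1]"
  have rest: "rest = map I.add_wt rm"
    unfolding rest_def
  proof (rule map_cong[OF refl])
    fix x assume "x \<in> set rm"
    then have x: "x \<in> I0.moves" "x \<notin> set pm" by (auto simp: rm)
    obtain q g q' a where q: "x = (q, g, q', a)" by (cases x)
    \<comment> \<open>Initial values enter only the bottom edges of check states. Those outside
      \<open>pm\<close> concern counters from 3 on, where \<open>V0\<close> and \<open>V\<close>
      agree.\<close>
    have "8 \<le> q" if "2 \<le> q" "g = 0"
      using x that by (auto simp: q pm_def I0.moves_def)
    then have "V (chk q) = V0 (chk q)" if "2 \<le> q" "g = 0"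
      using that by (auto simp: V_def V0_def v0_def chk_def)
    then show "I0.add_wt x = I.add_wt x" by (auto simp: q)
  qed
  have pm: "map I.add_wt pm =
      map (\<lambda>q. (q, 0, 0, Skip, d * sg q * (2 * int (xs ! chk q) - 1))) [2..<8]"
    using K by (auto simp: pm_def V_def v0_def chk_def)
  have "set pm \<subseteq> I0.moves" using K by (auto simp: pm_def I0.moves_def)
  then have moves: "set (pm @ rm) = I.moves" by (auto simp: rm)
  have "distinct pm" by (simp add: pm_def distinct_map inj_on_def)
  then have "distinct (pm @ rm)" using rm by auto
  moreover have "map (\<lambda>(q, g, q', a, w). (q, g, q', a)) (map I.add_wt l) = l" for l
    by (induction l) auto
  ultimately interpret counter_arena m K src dst opr "[]" V d G
    by unfold_locales
      (use d moves in \<open>auto simp: G_def simp del: map_append map_map set_append\<close>)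
  interpret program_game m K src dst opr "[]" V d D v0
    by unfold_locales (use dst sound complete in \<open>auto simp: V_def\<close>)
  have enc: "eval_recf (rgame d) xs (enc_wpg G)"
    using eval_rgame[OF d _ pos, of rest] by (simp add: G_def xs_def pm rest)
  show thesis
  proof (rule that[OF wf_G _ enc])
    show "length xs = 3" by (simp add: xs_def)
  qed (use prover_wins_iff challenger_wins_iff halts_iff_exec in \<open>auto simp: v0_def[abs_def]\<close>)
qed

theorem theorem4:
  fixes \<Phi> :: avg and r :: cmp and bnd fm :: bool
  shows "\<not> decidable_on enc_wpg wf_wpg (\<lambda>G. player1_wins G \<Phi> r bnd fm)"
proof
  assume "decidable_on enc_wpg wf_wpg (\<lambda>G. player1_wins G \<Phi> r bnd fm)"
  then obtain f where f: "\<And>G. wf_wpg G \<Longrightarrow>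
      eval_recf f [enc_wpg G] (if player1_wins G \<Phi> r bnd fm then 1 else 0)"
    unfolding decidable_on_def by blast
  \<comment> \<open>The remaining case, non-strict without stack boundedness, is handled by the game
    with exchanged roles.\<close>
  define direct where "direct \<longleftrightarrow> r = Gt \<or> bnd"
  define d :: int where "d = (if direct then 1 else - 1)"
  \<comment> \<open>With exchanged roles a win means that the program does not halt, so the answer
    is negated: in both cases 1 predicts that \<open>D\<close> halts on the description of its own
    game.\<close>
  define F where "F = (if direct then Comp f [rgame d] else Comp rnot [Comp f [rgame d]])"
  \<comment> \<open>Registers 0 to 2 hold the input, 3 the prediction, and scratch space starts at
    4. The final loop runs forever exactly if halting was predicted.\<close>
  define D where "D = compile F [0, 1, 2] 3 4 @ [Loop 3 [Inc 3]]"
  have d: "d = 1 \<or> d = - 1" by (simp add: d_def)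
  obtain xs G where G: "wf_wpg G" "length xs = 3" "eval_recf (rgame d) xs (enc_wpg G)"
    and direct: "\<And>\<Phi> r bnd fm. d = 1 \<Longrightarrow> r = Gt \<or> bnd \<Longrightarrow>
      player1_wins G \<Phi> r bnd fm \<longleftrightarrow> (\<exists>v. exec D (\<lambda>c. if c < 3 then xs ! c else 0) v)"
    and dual: "\<And>\<Phi> fm. d = - 1 \<Longrightarrow>
      player1_wins G \<Phi> Geq False fm \<longleftrightarrow> \<not> (\<exists>v. exec D (\<lambda>c. if c < 3 then xs ! c else 0) v)"
    by (rule game_for_program[OF d, of D]) (rule that, assumption+)
  define v0 where "v0 = (\<lambda>c. if c < 3 then xs ! c else 0)"
  define h where "h \<longleftrightarrow> (\<exists>v. exec D v0 v)"
  define y :: nat where "y = (if h then 1 else 0)"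
  note fG = eval_Comp1[OF G(3) f[OF G(1)]]
  have "eval_recf F xs y"
  proof (cases direct)
    case True
    with fG direct show ?thesis by (simp add: F_def y_def h_def v0_def d_def direct_def)
  next
    case False
    then have *: "r = Geq" "\<not> bnd" by (auto simp: direct_def intro: cmp.exhaust)
    from eval_Comp1[OF fG eval_rnot] dual False * show ?thesis
      by (auto simp: F_def y_def h_def v0_def d_def split: if_splits)
  qed
  from compile_correct[OF this] have run: "exec (compile F [0, 1, 2] 3 4) v0 (v0(3 := y))"
  proof (rule computesD)
    show "map v0 [0, 1, 2] = xs"
      using G(2) by (auto simp: v0_def numeral_3_eq_3 length_Suc_conv)
  qed (auto simp: v0_def)
  show False
  proof (cases h)
    case True
    then obtain v where "exec D v0 v" by (auto simp: h_def)
    from exec_appendD[OF this[unfolded D_def] run] have "(v0(3 := y)) 3 = 0"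
      by (rule Loop_Inc_diverges)
    with True show False by (simp add: y_def)
  next
    case False
    have "exec [Loop 3 [Inc 3]] (v0(3 := y)) (v0(3 := y))"
      by (rule exec_Exit[OF _ exec_Nil]) (use False in \<open>simp add: y_def\<close>)
    from exec_append[OF run this] False show False by (auto simp: h_def D_def)
  qed
qed

end
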